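(* Consider the gated-service M/GI/1 queue with single vacations described in the context. Suppose an arrival at time $0$ breaks an idle period, let $T^*$ be the time at which the resulting busy cycle ends and $N^*$ the total number of customers served in $(0,T^*]$. If $\rho=\lambda\mathrm{E}[H]<1$ and $\mathrm{E}[V]<\infty$, then the joint transform $\theta^*(z,\omega)=\mathrm{E}\big[z^{N^*}e^{-\omega T^*}\big]$ of $N^*$ and $T^*$ is given by \[ \theta^*(z,\omega)=\frac{\displaystyle\sum_{n=1}^{\infty}\psi_n^H(z,\omega,0)\prod_{m=1}^n\psi_m^V(z,\omega,0)}{1+\displaystyle\sum_{n=1}^{\infty}\prod_{m=1}^n\psi_m^V(z,\omega,0)}. \]
   Context: Model (gated-service M/GI/1 queue with single vacations). Customers arrive according to a Poisson process with rate $\lambda$. Service times are i.i.d. nonnegative random variables distributed as $H$, vacation lengths are i.i.d. nonnegative random variables distributed as $V$; arrivals, service times and vacation lengths are mutually independent. The single server operates as follows. (i) When the system is empty and the server is idle, the server waits for the next arrival and starts service of that customer as soon as it arrives; after completing this one service, the server takes a vacation. (ii-a) If there are $k\ge 1$ waiting customers on return from a vacation, the server serves exactly those $k$ customers successively and then takes another vacation (customers arriving during these services wait until after that vacation). (ii-b) If the system is empty on return from a vacation, the server becomes idle. A busy cycle is the interval from the end of an idle period (an arrival to the empty system with idle server) to the start of the next idle period (the first subsequent end of a vacation at which the system is empty). The customer arriving at time $0$ is counted in $N^*$. Notation: $h^*(s)=\mathrm{E}[e^{-sH}]$ and $v^*(s)=\mathrm{E}[e^{-sV}]$ are the Laplace-Stieltjes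 transforms of the service time and vacation length distributions. The functions $\psi_k^H$ and $\psi_k^V$ are given recursively by \[ \psi_1^H(z,\omega,\eta)=z h^*(\omega+\lambda-\lambda\eta),\qquad \psi_k^H(z,\omega,\eta)=z h^*\big(\omega+\lambda-\lambda\psi_{k-1}^H(z,\omega,\eta)\big),\quad k=2,3,\ldots, \] \[ \psi_1^V(z,\omega,\eta)=v^*(\omega+\lambda-\lambda\eta),\qquad \psi_k^V(z,\omega,\eta)=v^*\big(\omega+\lambda-\lambda\psi_{k-1}^H(z,\omega,\eta)\big),\quad k=2,3,\ldots. \] *)

theory Defs
  imports "HOL-Probability.Probability"
begin

locale poisson_process = prob_space M for M :: "'a measure" +
  fixes rate :: real and A :: "real \<Rightarrow> 'a \<Rightarrow> nat"
  assumes rate_pos: "0 < rate"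
    and count_measurable: "\<And>t. 0 \<le> t \<Longrightarrow> A t \<in> measurable M (count_space UNIV)"
    and count_zero: "\<And>x. x \<in> space M \<Longrightarrow> A 0 x = 0"
    and count_mono: "\<And>x. x \<in> space M \<Longrightarrow> mono_on {0..} (\<lambda>t. A t x)"
    and count_right_continuous:
      "\<And>x t. x \<in> space M \<Longrightarrow> 0 \<le> t \<Longrightarrow> continuous (at_right t) (\<lambda>s. A s x)"
    and increment_poisson:
      "\<And>s t. 0 \<le> s \<Longrightarrow> s < t \<Longrightarrow>
         distr M (count_space UNIV) (\<lambda>x. A t x - A s x) = measure_pmf (poisson_pmf (rate * (t - s)))"
    and increments_indep:
      "\<And>(n::nat) t. 0 \<le> t 0 \<Longrightarrow> mono t \<Longrightarrow>
         indep_vars (\<lambda>_. count_space UNIV) (\<lambda>i x. A (t (Suc i)) x - A (t i) x) {..<n}"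

datatype source = Arrivals | Service nat | Vacation nat

fun source_events ::
  "'a measure \<Rightarrow> (real \<Rightarrow> 'a \<Rightarrow> nat) \<Rightarrow> (nat \<Rightarrow> 'a \<Rightarrow> real) \<Rightarrow> (nat \<Rightarrow> 'a \<Rightarrow> real) \<Rightarrow> source \<Rightarrow> 'a set set"
where
  "source_events M A H V Arrivals =
     sigma_sets (space M) {A t -` B \<inter> space M | t B. 0 \<le> t}"
| "source_events M A H V (Service i) = {H i -` B \<inter> space M | B. B \<in> sets borel}"
| "source_events M A H V (Vacation i) = {V i -` B \<inter> space M | B. B \<in> sets borel}"

text \<open>
  Time \<open>0\<close> is the instant at which a customer arrives at the empty system with an idle server.
  \<open>A t\<close> is the number of further arrivals in \<open>(0, t]\<close>, \<open>H i\<close> is the service time of the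
  \<open>i\<close>-th customer to be served (from \<open>i = 0\<close>, the customer arriving at time \<open>0\<close>) and \<open>V i\<close> is
  the \<open>i\<close>-th vacation length (from \<open>i = 0\<close>).
\<close>

locale gated_vacation_queue = poisson_process M rate A
  for M :: "'a measure" and rate :: real and A :: "real \<Rightarrow> 'a \<Rightarrow> nat" +
  fixes service_law vacation_law :: "real measure"
    and H V :: "nat \<Rightarrow> 'a \<Rightarrow> real"
  assumes service_measurable: "\<And>i. H i \<in> borel_measurable M"
    and vacation_measurable: "\<And>i. V i \<in> borel_measurable M"
    and service_nonneg: "\<And>i x. x \<in> space M \<Longrightarrow> 0 \<le> H i x"
    and vacation_nonneg: "\<And>i x. x \<in> space M \<Longrightarrow> 0 \<le> V i x"
    and service_distr: "\<And>i. distr M borel (H i) = service_law"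
    and vacation_distr: "\<And>i. distr M borel (V i) = vacation_law"
    and sources_indep: "indep_sets (source_events M A H V) UNIV"

text \<open>
  The following functions describe one sample path: \<open>a\<close>, \<open>h\<close>, \<open>v\<close> are realizations of the
  arrival counts, service times and vacation lengths.
\<close>

text \<open>Customers present at time \<open>t\<close> when \<open>j\<close> have been served; \<open>Suc\<close> accounts for the customer
  arriving at time \<open>0\<close>.\<close>

definition waiting :: "(real \<Rightarrow> nat) \<Rightarrow> real \<Rightarrow> nat \<Rightarrow> nat" where
  "waiting a t j = Suc (a t) - j"

text \<open>
  The epoch at which the \<open>n\<close>-th vacation ends, paired with the number of customers served by
  then; for \<open>n = 0\<close> this is the start of the busy cycle. Everyone waiting at an epoch (at epoch
  \<open>0\<close>, the single customer who breaks the idle period) is served, and then a vacation is taken.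
  The server idles at the first epoch \<open>n \<ge> 1\<close> with nobody waiting, so only the values up to that
  epoch describe the queue.
\<close>

primrec vacation_end ::
  "(real \<Rightarrow> nat) \<Rightarrow> (nat \<Rightarrow> real) \<Rightarrow> (nat \<Rightarrow> real) \<Rightarrow> nat \<Rightarrow> real \<times> nat" where
  "vacation_end a h v 0 = (0, 0)"
| "vacation_end a h v (Suc n) =
     (let (t, j) = vacation_end a h v n; k = waiting a t j
      in (t + (\<Sum>i = j..<j + k. h i) + v n, j + k))"

definition empty_at_vacation_end ::
  "(real \<Rightarrow> nat) \<Rightarrow> (nat \<Rightarrow> real) \<Rightarrow> (nat \<Rightarrow> real) \<Rightarrow> nat \<Rightarrow> bool" where
  "empty_at_vacation_end a h v n \<longleftrightarrow>
     waiting a (fst (vacation_end a h v n)) (snd (vacation_end a h v n)) = 0"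

definition busy_cycle_ends :: "(real \<Rightarrow> nat) \<Rightarrow> (nat \<Rightarrow> real) \<Rightarrow> (nat \<Rightarrow> real) \<Rightarrow> bool" where
  "busy_cycle_ends a h v \<longleftrightarrow> (\<exists>n\<ge>1. empty_at_vacation_end a h v n)"

definition cycle_vacations :: "(real \<Rightarrow> nat) \<Rightarrow> (nat \<Rightarrow> real) \<Rightarrow> (nat \<Rightarrow> real) \<Rightarrow> nat" where
  "cycle_vacations a h v = (LEAST n. 1 \<le> n \<and> empty_at_vacation_end a h v n)"

text \<open>The next two values, \<open>T\<^sup>*\<close> and \<open>N\<^sup>*\<close>, are meaningful only on paths on which the busy cycle ends.\<close>

definition cycle_length :: "(real \<Rightarrow> nat) \<Rightarrow> (nat \<Rightarrow> real) \<Rightarrow> (nat \<Rightarrow> real) \<Rightarrow> real" where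
  "cycle_length a h v = fst (vacation_end a h v (cycle_vacations a h v))"

definition cycle_served :: "(real \<Rightarrow> nat) \<Rightarrow> (nat \<Rightarrow> real) \<Rightarrow> (nat \<Rightarrow> real) \<Rightarrow> nat" where
  "cycle_served a h v = snd (vacation_end a h v (cycle_vacations a h v))"

definition joint_transform ::
  "'a measure \<Rightarrow> (real \<Rightarrow> 'a \<Rightarrow> nat) \<Rightarrow> (nat \<Rightarrow> 'a \<Rightarrow> real) \<Rightarrow> (nat \<Rightarrow> 'a \<Rightarrow> real)
     \<Rightarrow> complex \<Rightarrow> complex \<Rightarrow> complex" where
  "joint_transform M A H V z \<omega> =
     (LINT x|M. z ^ cycle_served (\<lambda>t. A t x) (\<lambda>i. H i x) (\<lambda>i. V i x)
        * exp (- \<omega> * of_real (cycle_length (\<lambda>t. A t x) (\<lambda>i. H i x) (\<lambda>i. V i x))))"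

definition lst :: "real measure \<Rightarrow> complex \<Rightarrow> complex" where
  "lst \<mu> s = (LINT x|\<mu>. exp (- s * of_real x))"

text \<open>
  With the convention \<open>\<psi>\<^sub>0\<^sup>H = \<eta>\<close>, the formulas for index \<open>1\<close> are instances of those for
  \<open>k \<ge> 2\<close>. \<open>psi_V\<close> is used for \<open>k \<ge> 1\<close> only.
\<close>

primrec psi_H :: "real measure \<Rightarrow> real \<Rightarrow> nat \<Rightarrow> complex \<Rightarrow> complex \<Rightarrow> complex \<Rightarrow> complex" where
  "psi_H service_law rate 0 z \<omega> \<eta> = \<eta>"
| "psi_H service_law rate (Suc k) z \<omega> \<eta> =
     z * lst service_law (\<omega> + of_real rate - of_real rate * psi_H service_law rate k z \<omega> \<eta>)"

definition psi_V ::
  "real measure \<Rightarrow> real measure \<Rightarrow> real \<Rightarrow> nat \<Rightarrow> complex \<Rightarrow> complex \<Rightarrow> complex \<Rightarrow> complex" where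
  "psi_V service_law vacation_law rate k z \<omega> \<eta> =
     lst vacation_law (\<omega> + of_real rate - of_real rate * psi_H service_law rate (k - 1) z \<omega> \<eta>)"

end

(*
  Let the vacations continue after the busy cycle, one after the other, also when the system is empty.
  The numbers of customers K_n present at the ends t_n of the vacations then form a Markov chain, and
  with j_n served customers E[z^{j_n} e^{-\<omega> t_n} u^{K_n}] is found by iterating the one-step map
  u |-> \<psi>_1^H(u), each step contributing a factor \<psi>_1^V. At u = 0 this is the transform over the event
  K_n = 0, namely (\<psi>_n^H)^c b_n with b_n = \<psi>_1^V ... \<psi>_n^V if there are c customers at time 0.
  Decomposing this event according to the first n with K_n = 0 gives a renewal equation with the
  transforms f_k^c of the first passage to 0:

    (\<psi>_n^H)^c b_n = \<Sum>_{k=1..n} f_k^c b_{n-k}   (n \<ge> 1).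

  For c = 1 summation yields \<Sum>_{n\<ge>1} \<psi>_n^H b_n = \<theta>* \<Sum>_{n\<ge>0} b_n. For c = 0 it yields B - 1 = G B for
  B = \<Sum>_{n\<ge>0} b_n, so that B \<noteq> 0. Only convergence of B is needed, since the f_k^c are absolutely summable.

  The cycle ends almost surely: for z = 1 and \<omega> = 0, 1 - \<psi>_n^H \<le> \<rho>^n, so b_n has a positive limit L, and
  letting n tend to infinity in the renewal equation gives L = P(the cycle ends) L.
*)

theory Submission
  imports Defs
begin

section \<open>Convolutions and Laplace--Stieltjes transforms\<close>

text \<open>Tannery's theorem: after extension by zero for \<open>k > n\<close>, each term tends to
  \<open>f k * L\<close>, and \<open>norm (f k)\<close> times a bound of the convergent sequence
  \<open>b\<close> dominates.\<close>

lemma convolution_tendsto: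
  fixes f b :: "nat \<Rightarrow> complex"
  assumes f: "summable (\<lambda>n. norm (f n))" and b: "b \<longlonglongrightarrow> L"
  shows "(\<lambda>n. \<Sum>k\<le>n. f k * b (n - k)) \<longlonglongrightarrow> suminf f * L"
proof -
  obtain C where C: "\<And>n. norm (b n) \<le> C"
    using convergent_imp_Bseq[OF convergentI[OF b]] unfolding Bseq_def by blast
  define a where "a k n = (if k \<le> n then f k * b (n - k) else 0)" for k n
  have "(\<lambda>n. a k n) \<longlonglongrightarrow> f k * L" for k
  proof -
    have "(\<lambda>n. a k (n + k)) \<longlonglongrightarrow> f k * L"
      unfolding a_def using b by (simp add: tendsto_mult_left)
    then show ?thesis by (rule LIMSEQ_offset)
  qed
  moreover have "norm (a k n) \<le> norm (f k) * C" for k n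
    using C[of "n - k"] order_trans[OF norm_ge_zero C[of 0]]
    by (simp add: a_def norm_mult mult_left_mono)
  then have "eventually (\<lambda>(k, n). norm (a k n) \<le> norm (f k) * C) (at_top \<times>\<^sub>F sequentially)"
    by (intro always_eventually) auto
  ultimately have "(\<lambda>n. suminf (\<lambda>k. a k n)) \<longlonglongrightarrow> (\<Sum>k. f k * L)"
    using tannerys_theorem[where a=a and b="\<lambda>k. f k * L" and M="\<lambda>k. norm (f k) * C" and F=sequentially]
      summable_mult2[OF f, of C] by simp
  moreover have "suminf (\<lambda>k. a k n) = (\<Sum>k\<le>n. f k * b (n - k))" for n
    by (subst suminf_finite[of "{..n}"]) (auto simp: a_def)
  moreover have "(\<Sum>k. f k * L) = suminf f * L"
    using suminf_mult2[OF summable_norm_cancel[OF f]] by simp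
  ultimately show ?thesis by simp
qed

lemma sum_convolution:
  fixes f b :: "nat \<Rightarrow> complex"
  shows "(\<Sum>n\<le>N. \<Sum>k\<le>n. f k * b (n - k)) = (\<Sum>k\<le>N. f k * (\<Sum>m\<le>N - k. b m))"
proof (induction N)
  case (Suc N)
  have "(\<Sum>k\<le>Suc N. f k * (\<Sum>m\<le>Suc N - k. b m))
      = (\<Sum>k\<le>N. f k * (\<Sum>m\<le>N - k. b m) + f k * b (Suc N - k)) + f (Suc N) * b 0"
    by (auto simp: Suc_diff_le distrib_left intro!: sum.cong)
  then show ?case using Suc by (simp add: sum.distrib)
qed simp

text \<open>Mertens' theorem: the partial sums of a convolution are the convolution of
  \<open>f\<close> with the partial sums of \<open>b\<close>. Only \<open>f\<close> is taken
  absolutely summable, as the convergence assumed in the theorem need not be absolute.\<close>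

lemma renewal_sums:
  fixes f b a :: "nat \<Rightarrow> complex"
  assumes f: "summable (\<lambda>n. norm (f n))" and b: "summable b"
    and a: "\<And>n. a n = (\<Sum>k\<le>n. f k * b (n - k))"
  shows "a sums (suminf f * suminf b)"
proof -
  have "(\<lambda>N. \<Sum>n\<le>N. b n) \<longlonglongrightarrow> suminf b"
    using summable_LIMSEQ'[OF b] .
  from convolution_tendsto[OF f this]
  show ?thesis
    unfolding sums_def_le a sum_convolution .
qed

text \<open>Mean value inequality on the left half-plane, which is convex and on which the
  derivative of \<open>exp\<close> has norm at most 1.\<close>

lemma norm_exp_minus_one_le:
  fixes w :: complex
  assumes "Re w \<le> 0"
  shows "norm (exp w - 1) \<le> norm w"
proof -
  have "norm (exp w - exp 0) \<le> 1 * norm (w - 0)"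
  proof (rule field_differentiable_bound[where S="{u. Re u \<le> 0}"])
    show "convex {u. Re u \<le> 0}" by (rule convex_halfspace_Re_le)
    show "(exp has_field_derivative exp u) (at u within {u. Re u \<le> 0})" for u :: complex
      by (rule DERIV_subset[OF DERIV_exp]) simp
    show "norm (exp u) \<le> 1" if "u \<in> {u. Re u \<le> 0}" for u :: complex
      using that by simp
  qed (use assms in auto)
  then show ?thesis by simp
qed

lemma norm_integral_le:
  fixes f :: "'a \<Rightarrow> 'b::{banach, second_countable_topology}"
  assumes "integrable M f" "integrable M g" "\<And>x. x \<in> space M \<Longrightarrow> norm (f x) \<le> g x"
  shows "norm (LINT x|M. f x) \<le> (LINT x|M. g x)"
  using assms by (intro order_trans[OF integral_norm_bound] integral_mono) auto

section \<open>Bounds for Laplace-Stieltjes transforms of nonnegative variables\<close>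

context prob_space
begin

context
  fixes X :: "'a \<Rightarrow> real"
  assumes X[measurable]: "X \<in> borel_measurable M" and X_nonneg: "\<And>x. x \<in> space M \<Longrightarrow> 0 \<le> X x"
begin

lemma lst_distr: "lst (distr M borel X) s = (LINT x|M. exp (- s * of_real (X x)))"
  unfolding lst_def by (rule integral_distr) measurable

lemma integrable_exp_neg:
  assumes "0 \<le> Re s"
  shows "integrable M (\<lambda>x. exp (- s * of_real (X x)))"
  using assms X_nonneg by (intro integrable_const_bound[where B=1]) auto

lemma norm_lst_le:
  assumes "0 \<le> Re s"
  shows "norm (lst (distr M borel X) s) \<le> 1"
proof -
  have "norm (lst (distr M borel X) s) \<le> (LINT x|M. 1)"
    unfolding lst_distr
    by (rule norm_integral_le)
      (use assms X_nonneg integrable_exp_neg in auto)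
  then show ?thesis by (simp add: prob_space)
qed

text \<open>This estimate is where finite means enter: it yields the geometric rate at which the
  iterates approach 1 when z = 1 and \<omega> = 0.\<close>

lemma norm_lst_minus_one_le:
  assumes s: "0 \<le> Re s" and int: "integrable M X"
  shows "norm (lst (distr M borel X) s - 1) \<le> norm s * expectation X"
proof -
  have "lst (distr M borel X) s - 1 = (LINT x|M. exp (- s * of_real (X x)) - 1)"
    unfolding lst_distr using integrable_exp_neg[OF s] by (simp add: prob_space)
  also have "norm \<dots> \<le> (LINT x|M. norm s * X x)"
  proof (rule norm_integral_le)
    fix x assume x: "x \<in> space M"
    have "norm (exp (- s * of_real (X x)) - 1) \<le> norm (- s * of_real (X x))"
      using X_nonneg[OF x] s by (intro norm_exp_minus_one_le) simp
    then show "norm (exp (- s * of_real (X x)) - 1) \<le> norm s * X x"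
      using X_nonneg[OF x] by (simp add: norm_mult)
  qed (use int integrable_exp_neg[OF s] in auto)
  finally show ?thesis by simp
qed

text \<open>A nonnegative function with integral zero vanishes almost everywhere, which an
  exponential never does. Positivity keeps the factors of an infinite product nonzero later.\<close>

lemma lst_of_real:
  assumes "0 \<le> r"
  shows "lst (distr M borel X) (of_real r) = of_real (expectation (\<lambda>x. exp (- r * X x)))"
    and "0 < expectation (\<lambda>x. exp (- r * X x))"
proof -
  show "lst (distr M borel X) (of_real r) = of_real (expectation (\<lambda>x. exp (- r * X x)))"
    unfolding lst_distr integral_complex_of_real[symmetric]
    by (intro Bochner_Integration.integral_cong refl) (simp flip: exp_of_real)
  have int: "integrable M (\<lambda>x. exp (- r * X x))"
    using assms X_nonneg by (intro integrable_const_bound[where B=1]) auto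
  show "0 < expectation (\<lambda>x. exp (- r * X x))"
    using integral_nonneg_eq_0_iff_AE[OF int] by (auto simp: less_le)
qed

text \<open>The bound \<open>q\<close> is the transform at \<open>\<delta>\<close>. If
  \<open>X\<close> vanished almost surely, the transform would be 1 everywhere; the positive mass on
  the positive axis excludes this.\<close>

lemma norm_lst_le_uniform:
  assumes pos: "0 < measure (distr M borel X) {0<..}" and \<delta>: "0 < \<delta>"
  obtains q where "0 \<le> q" "q < 1" "\<And>s. \<delta> \<le> Re s \<Longrightarrow> norm (lst (distr M borel X) s) \<le> q"
proof
  let ?q = "expectation (\<lambda>x. exp (- \<delta> * X x))"
  have int: "integrable M (\<lambda>x. exp (- \<delta> * X x))"
    using \<delta> X_nonneg by (intro integrable_const_bound[where B=1]) auto
  show "0 \<le> ?q" by simp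
  \<comment> \<open>Otherwise the nonnegative variable \<open>1 - exp (- \<delta> * X x)\<close> has
    mean zero, which forces \<open>X = 0\<close> almost surely.\<close>
  have "?q \<noteq> 1"
  proof
    assume "?q = 1"
    then have "expectation (\<lambda>x. 1 - exp (- \<delta> * X x)) = 0"
      using int by (simp add: prob_space)
    then have "AE x in M. 1 - exp (- \<delta> * X x) = 0"
      by (subst (asm) integral_nonneg_eq_0_iff_AE) (use int \<delta> X_nonneg in auto)
    then have "AE x in M. \<not> X x > 0"
      by eventually_elim (use \<delta> in auto)
    then have "prob {x \<in> space M. X x > 0} = 0"
      by (subst prob_eq_0) auto
    moreover have "measure (distr M borel X) {0<..} = prob {x \<in> space M. X x > 0}"
      by (subst measure_distr) (auto intro!: arg_cong[where f=prob])
    ultimately show False using pos by simp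
  qed
  moreover have "?q \<le> (LINT x|M. 1)"
    using int \<delta> X_nonneg by (intro integral_mono) auto
  ultimately show "?q < 1" by (simp add: prob_space)
  show "norm (lst (distr M borel X) s) \<le> ?q" if s: "\<delta> \<le> Re s" for s
    unfolding lst_distr
  proof (rule norm_integral_le)
    fix x assume x: "x \<in> space M"
    show "norm (exp (- s * of_real (X x))) \<le> exp (- \<delta> * X x)"
      using X_nonneg[OF x] s by (simp add: mult_right_mono)
  qed (use int integrable_exp_neg \<delta> s in auto)
qed

end

end

section \<open>Sample paths\<close>

text \<open>In \<open>\<eta>\<close>, \<open>psi_H\<close> is an iterate of the map for index 1, so
  one application may be split off at either end. The recursion splits off the outermost; removing
  the last epoch of a path needs the innermost.\<close>

lemma psi_H_Suc_shift:
  "psi_H \<mu> r (Suc k) z \<omega> \<eta> = psi_H \<mu> r k z \<omega> (psi_H \<mu> r 1 z \<omega> \<eta>)"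
  by (induction k) simp_all

lemma prod_psi_V_Suc_shift:
  "(\<Prod>m = 1..Suc n. psi_V \<mu> \<nu> r m z \<omega> \<eta>)
    = psi_V \<mu> \<nu> r 1 z \<omega> \<eta> * (\<Prod>m = 1..n. psi_V \<mu> \<nu> r m z \<omega> (psi_H \<mu> r 1 z \<omega> \<eta>))"
proof -
  have "(\<Prod>m = Suc 1..Suc n. psi_V \<mu> \<nu> r m z \<omega> \<eta>)
      = (\<Prod>m = 1..n. psi_V \<mu> \<nu> r (Suc m) z \<omega> \<eta>)"
    by (rule prod.shift_bounds_cl_Suc_ivl)
  also have "\<dots> = (\<Prod>m = 1..n. psi_V \<mu> \<nu> r m z \<omega> (psi_H \<mu> r 1 z \<omega> \<eta>))"
  proof (rule prod.cong)
    fix m assume "m \<in> {1..n}"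
    \<comment> \<open>Index 0 must be kept out: by truncated subtraction \<open>psi_V\<close> has
      the same value at 0 and at 1, so the shift would fail there.\<close>
    then obtain k where "m = Suc k" by (cases m) auto
    then show "psi_V \<mu> \<nu> r (Suc m) z \<omega> \<eta> = psi_V \<mu> \<nu> r m z \<omega> (psi_H \<mu> r 1 z \<omega> \<eta>)"
      unfolding psi_V_def by (simp add: psi_H_Suc_shift[of _ _ k] del: psi_H.simps(2))
  qed simp
  finally show ?thesis
    by (subst prod.atLeast_Suc_atMost) simp_all
qed

text \<open>The epochs of \<^const>\<open>vacation_end\<close>, but with \<open>c\<close> customers at time \<open>0\<close>: \<open>c = 1\<close> is the busy
  cycle, and \<open>c = 0\<close> describes the return to the empty state, which shows that the denominator of
  the theorem is nonzero.\<close>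

primrec chain ::
  "nat \<Rightarrow> (real \<Rightarrow> nat) \<Rightarrow> (nat \<Rightarrow> real) \<Rightarrow> (nat \<Rightarrow> real) \<Rightarrow> nat \<Rightarrow> real \<times> nat" where
  "chain c a h v 0 = (0, 0)"
| "chain c a h v (Suc n) =
     (let (t, j) = chain c a h v n; k = c + a t - j
      in (t + (\<Sum>i = j..<j + k. h i) + v n, j + k))"

definition queue :: "nat \<Rightarrow> (real \<Rightarrow> nat) \<Rightarrow> (nat \<Rightarrow> real) \<Rightarrow> (nat \<Rightarrow> real) \<Rightarrow> nat \<Rightarrow> nat" where
  "queue c a h v n = c + a (fst (chain c a h v n)) - snd (chain c a h v n)"

lemma vacation_end_eq_chain: "vacation_end a h v n = chain 1 a h v n"
  by (induction n) (simp_all add: waiting_def)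

lemma empty_at_vacation_end_iff: "empty_at_vacation_end a h v n \<longleftrightarrow> queue 1 a h v n = 0"
  by (simp add: empty_at_vacation_end_def waiting_def queue_def vacation_end_eq_chain)

lemma chain_Suc:
  "chain c a h v (Suc n) =
    (fst (chain c a h v n)
      + sum h {snd (chain c a h v n)..<snd (chain c a h v n) + queue c a h v n} + v n,
     snd (chain c a h v n) + queue c a h v n)"
  by (simp add: Let_def case_prod_beta queue_def)

text \<open>With queue lengths \<open>k\<close>, this is the index of the first customer served in
  period \<open>n\<close>, a period being a batch of services with the vacation after it.\<close>

definition gate :: "(nat \<Rightarrow> nat) \<Rightarrow> nat \<Rightarrow> nat" where
  "gate k n = sum k {..<n}"

definition period :: "(nat \<Rightarrow> nat) \<Rightarrow> (nat \<Rightarrow> real) \<Rightarrow> (nat \<Rightarrow> real) \<Rightarrow> nat \<Rightarrow> real" where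
  "period k h v n = sum h {gate k n..<gate k (Suc n)} + v n"

text \<open>If the queue lengths at the epochs are prescribed to be \<open>k\<close>, then the customers served in a
  period, and hence its length, no longer depend on the arrivals.\<close>

lemma chain_on_path:
  assumes "\<And>i. i < n \<Longrightarrow> queue c a h v i = k i"
  shows "chain c a h v n = (sum (period k h v) {..<n}, gate k n)"
  using assms
proof (induction n)
  case (Suc n)
  then show ?case
    by (simp add: chain_Suc period_def gate_def del: chain.simps(2))
qed (simp add: gate_def)

context
  fixes a :: "real \<Rightarrow> nat" and h v :: "nat \<Rightarrow> real"
  assumes a_zero: "a 0 = 0" and a_mono: "mono_on {0..} a"
    and h_nonneg: "\<And>i. 0 \<le> h i" and v_nonneg: "\<And>i. 0 \<le> v i"
begin

lemma chain_time_nonneg: "0 \<le> fst (chain c a h v n)"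
  by (induction n) (auto simp: chain_Suc h_nonneg v_nonneg sum_nonneg simp del: chain.simps(2))

text \<open>Each batch takes in everyone who has arrived by its start, and arrivals only increase.
  Hence the truncated subtraction in \<open>queue\<close> is exact.\<close>

lemma chain_served_le: "snd (chain c a h v n) \<le> c + a (fst (chain c a h v n))"
proof (induction n)
  case (Suc n)
  then have "snd (chain c a h v (Suc n)) = c + a (fst (chain c a h v n))"
    by (simp add: chain_Suc queue_def del: chain.simps(2))
  also have "\<dots> \<le> c + a (fst (chain c a h v (Suc n)))"
    using a_mono chain_time_nonneg[of c n] chain_time_nonneg[of c "Suc n"]
    by (auto simp: chain_Suc h_nonneg v_nonneg sum_nonneg add_nonneg_nonneg
        intro!: mono_onD[OF a_mono] simp del: chain.simps(2))
  finally show ?case .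
qed simp

lemma queue_add_served: "snd (chain c a h v n) + queue c a h v n = c + a (fst (chain c a h v n))"
  using chain_served_le by (simp add: queue_def)

lemma queue_Suc:
  "queue c a h v (Suc n) = a (fst (chain c a h v (Suc n))) - a (fst (chain c a h v n))"
  unfolding queue_def[of _ _ _ _ "Suc n"]
  by (simp add: chain_Suc queue_add_served del: chain.simps(2))

text \<open>Inductively, a path prescribed up to epoch \<open>n\<close> pins epoch
  \<open>Suc n\<close> to a sum of periods. Path events thus become conditions on arrival increments
  over intervals determined by the work alone.\<close>

lemma path_iff:
  assumes "k 0 = c"
  shows "(\<forall>i\<le>n. queue c a h v i = k i) \<longleftrightarrow>
    (\<forall>i<n. a (sum (period k h v) {..<Suc i}) - a (sum (period k h v) {..<i}) = k (Suc i))"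
proof (induction n)
  case 0
  then show ?case using assms a_zero by (simp add: queue_def)
next
  case (Suc n)
  have "queue c a h v (Suc n)
      = a (sum (period k h v) {..<Suc n}) - a (sum (period k h v) {..<n})"
    if "\<forall>i\<le>n. queue c a h v i = k i"
    using chain_on_path[of n c a h v k] chain_on_path[of "Suc n" c a h v k] that
    by (simp add: queue_Suc del: chain.simps(2))
  then show ?case
    using Suc by (auto simp: le_Suc_eq less_Suc_eq)
qed

end

section \<open>Poisson arrivals at random times\<close>

text \<open>By right-continuity the count at \<open>t\<close> is a limit of counts at grid points to
  the right, of which each mesh has only countably many. Times are clamped by \<open>max 0\<close>
  because nothing is assumed at negative times.\<close>

lemma measurable_right_continuous_count:
  fixes A :: "real \<Rightarrow> 'a \<Rightarrow> nat"
  assumes meas: "\<And>t. 0 \<le> t \<Longrightarrow> A t \<in> measurable N (count_space UNIV)"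
    and cont: "\<And>x t. x \<in> space N \<Longrightarrow> 0 \<le> t \<Longrightarrow> continuous (at_right t) (\<lambda>s. A s x)"
  shows "(\<lambda>(x, t). A (max 0 t) x) \<in> measurable (N \<Otimes>\<^sub>M borel) (count_space UNIV)"
proof -
  \<comment> \<open>The first point of the grid of mesh \<open>1 / Suc m\<close> strictly beyond
    \<open>max 0 t\<close>; strictness makes the limit one from the right.\<close>
  define tm where "tm m t = (real_of_int \<lfloor>max 0 t * real (Suc m)\<rfloor> + 1) / real (Suc m)" for m t
  have tm_gt: "max 0 t < tm m t" for m t
    unfolding tm_def by (simp add: less_divide_eq)
  have tm_le: "tm m t \<le> max 0 t + 1 / real (Suc m)" for m t
    unfolding tm_def by (simp add: divide_le_eq distrib_right)
  have tm_lim: "(\<lambda>m. tm m t) \<longlonglongrightarrow> max 0 t" for t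
  proof (rule tendsto_sandwich[where f="\<lambda>_. max 0 t" and h="\<lambda>m. max 0 t + 1 / real (Suc m)"])
    have "(\<lambda>m. max 0 t + 1 / real (Suc m)) \<longlonglongrightarrow> max 0 t + 0"
      by (intro tendsto_add tendsto_const LIMSEQ_Suc lim_1_over_n)
    then show "(\<lambda>m. max 0 t + 1 / real (Suc m)) \<longlonglongrightarrow> max 0 t" by simp
    show "\<forall>\<^sub>F m in sequentially. max 0 t \<le> tm m t"
      by (intro always_eventually allI less_imp_le tm_gt)
    show "\<forall>\<^sub>F m in sequentially. tm m t \<le> max 0 t + 1 / real (Suc m)"
      by (intro always_eventually allI tm_le)
  qed simp
  have meas_tm: "(\<lambda>(x, t). real (A (tm m t) x)) \<in> borel_measurable (N \<Otimes>\<^sub>M borel)" for m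
  proof -
    define g where "g i p = real (A (max 0 ((real_of_int i + 1) / real (Suc m))) (fst p))"
      for i :: int and p :: "'a \<times> real"
    have [measurable]: "A (max 0 s) \<in> measurable N (count_space UNIV)" for s
      by (rule meas) simp
    have "(\<lambda>p. g \<lfloor>max 0 (snd p) * real (Suc m)\<rfloor> p) \<in> borel_measurable (N \<Otimes>\<^sub>M borel)"
      by (rule measurable_compose_countable[where f=g]) (unfold g_def, measurable)
    moreover have "g \<lfloor>max 0 (snd p) * real (Suc m)\<rfloor> p = real (A (tm m (snd p)) (fst p))" for p
      using tm_gt[of "snd p" m] unfolding g_def tm_def[symmetric] by simp
    ultimately show ?thesis
      by (simp add: case_prod_beta')
  qed
  have lim: "(\<lambda>m. real (A (tm m t) x)) \<longlonglongrightarrow> real (A (max 0 t) x)" if "x \<in> space N" for x t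
  proof -
    have "((\<lambda>s. A s x) \<longlongrightarrow> A (max 0 t) x) (at_right (max 0 t))"
      using cont[OF that, of "max 0 t"] by (simp add: continuous_within)
    moreover have "filterlim (\<lambda>m. tm m t) (at_right (max 0 t)) sequentially"
      using tm_lim[of t] tm_gt[of t] unfolding filterlim_at
      by (auto intro!: always_eventually simp: less_imp_neq[symmetric])
    ultimately have "(\<lambda>m. A (tm m t) x) \<longlonglongrightarrow> A (max 0 t) x"
      by (rule filterlim_compose)
    \<comment> \<open>Convergence in the discrete space of naturals means being eventually
      constant.\<close>
    then have "eventually (\<lambda>m. A (tm m t) x = A (max 0 t) x) sequentially"
      by (simp add: tendsto_discrete)
    then show ?thesis
      by (intro tendsto_eventually) (auto elim: eventually_mono)
  qed
  have "(\<lambda>p. real (A (max 0 (snd p)) (fst p))) \<in> borel_measurable (N \<Otimes>\<^sub>M borel)"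
    by (rule borel_measurable_LIMSEQ_real[OF _ meas_tm])
      (auto simp: space_pair_measure case_prod_beta intro!: lim)
  then have "(\<lambda>p. nat \<lfloor>real (A (max 0 (snd p)) (fst p))\<rfloor>) \<in> measurable (N \<Otimes>\<^sub>M borel) (count_space UNIV)"
    by measurable
  then show ?thesis by (simp add: case_prod_beta)
qed

context poisson_process
begin

lemma count_joint_measurable:
  "(\<lambda>(x, t). A (max 0 t) x) \<in> measurable (M \<Otimes>\<^sub>M borel) (count_space UNIV)"
  using count_measurable count_right_continuous by (rule measurable_right_continuous_count)

lemma count_at_measurable:
  assumes [measurable]: "T \<in> borel_measurable M" and "\<And>x. x \<in> space M \<Longrightarrow> 0 \<le> T x"
  shows "(\<lambda>x. A (T x) x) \<in> measurable M (count_space UNIV)"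
proof -
  have "(\<lambda>x. (\<lambda>(x, t). A (max 0 t) x) (x, T x)) \<in> measurable M (count_space UNIV)"
    using count_joint_measurable by (rule measurable_compose[rotated]) measurable
  then show ?thesis
    by (rule measurable_cong[THEN iffD1, rotated]) (simp add: assms(2))
qed

lemma distr_increment:
  assumes "0 \<le> s" "s \<le> t"
  shows "distr M (count_space UNIV) (\<lambda>x. A t x - A s x) = distr M (count_space UNIV) (A (t - s))"
proof (cases "s < t")
  case True
  have "distr M (count_space UNIV) (A (t - s)) = distr M (count_space UNIV) (\<lambda>x. A (t - s) x - A 0 x)"
    by (rule distr_cong) (simp_all add: count_zero)
  then show ?thesis
    using increment_poisson[of 0 "t - s"] increment_poisson[of s t] True assms by simp
next
  case False
  with assms have "s = t" by simp
  then show ?thesis by (intro distr_cong) (simp_all add: count_zero)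
qed

lemma pgf_count:
  fixes u :: complex
  assumes "0 \<le> t"
  shows "(LINT x|M. u ^ A t x) = exp (- of_real (rate * t) * (1 - u))"
proof (cases "t = 0")
  case True
  have "(LINT x|M. u ^ A t x) = (LINT x|M. 1)"
    using True by (intro Bochner_Integration.integral_cong) (simp_all add: count_zero)
  then show ?thesis using True by (simp add: prob_space)
next
  case False
  with assms have t: "0 < t" by simp
  then have r: "0 < rate * t" using rate_pos by simp
  have [measurable]: "A t \<in> measurable M (count_space UNIV)"
    using assms by (rule count_measurable)
  have "distr M (count_space UNIV) (A t) = distr M (count_space UNIV) (\<lambda>x. A t x - A 0 x)"
    by (rule distr_cong) (simp_all add: count_zero)
  also have "\<dots> = measure_pmf (poisson_pmf (rate * t))"
    using increment_poisson[of 0 t] t by simp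
  finally have d: "distr M (count_space UNIV) (A t) = measure_pmf (poisson_pmf (rate * t))" .
  have "(LINT x|M. u ^ A t x) = (LINT k|distr M (count_space UNIV) (A t). u ^ k)"
    by (subst integral_distr) auto
  also have "\<dots> = (LINT k|count_space UNIV. pmf (poisson_pmf (rate * t)) k *\<^sub>R u ^ k)"
    unfolding d measure_pmf_eq_density by (subst integral_density) auto
  also have "\<dots> = exp (- of_real (rate * t) * (1 - u))"
  proof -
    have sums: "(\<lambda>k. pmf (poisson_pmf (rate * t)) k *\<^sub>R u ^ k) sums
        (exp (of_real (rate * t) * u) * exp (- of_real (rate * t)))"
    proof -
      have "(\<lambda>k. (of_real (rate * t) * u) ^ k /\<^sub>R fact k * exp (- of_real (rate * t))) sums
        (exp (of_real (rate * t) * u) * exp (- of_real (rate * t)))"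
        by (intro sums_mult2 exp_converges)
      then show ?thesis
        using r by (simp add: scaleR_conv_of_real power_mult_distrib divide_simps mult_ac flip: exp_of_real)
    qed
    have "summable (\<lambda>k. norm (pmf (poisson_pmf (rate * t)) k *\<^sub>R u ^ k))"
    proof -
      have "(\<lambda>k. (rate * t * norm u) ^ k /\<^sub>R fact k * exp (- (rate * t))) sums
        (exp (rate * t * norm u) * exp (- (rate * t)))"
        by (intro sums_mult2 exp_converges)
      then show ?thesis
        using r rate_pos t by (intro sums_summable) (simp add: power_abs norm_mult norm_power power_mult_distrib divide_simps mult_ac abs_mult)
    qed
    then have "integrable (count_space UNIV) (\<lambda>k. pmf (poisson_pmf (rate * t)) k *\<^sub>R u ^ k)"
      by (simp add: integrable_count_space_nat_iff)
    then have "(LINT k|count_space UNIV. pmf (poisson_pmf (rate * t)) k *\<^sub>R u ^ k)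
        = exp (of_real (rate * t) * u) * exp (- of_real (rate * t))"
      using sums_unique[OF sums] by (simp add: integral_count_space_nat)
    then show ?thesis
      by (simp add: algebra_simps flip: exp_add)
  qed
  finally show ?thesis .
qed

lemma integral_prod_increments:
  fixes \<phi> :: "nat \<Rightarrow> nat \<Rightarrow> complex" and t :: "nat \<Rightarrow> real"
  assumes bound: "\<And>i k. norm (\<phi> i k) \<le> 1" and t: "0 \<le> t 0" "mono t"
  shows "(LINT x|M. (\<Prod>i<n. \<phi> i (A (t (Suc i)) x - A (t i) x)))
    = (\<Prod>i<n. (LINT x|M. \<phi> i (A (t (Suc i) - t i) x)))"
proof -
  have t_nonneg: "0 \<le> t i" for i
    using t monoD[of t 0 i] by simp
  have t_Suc: "t i \<le> t (Suc i)" for i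
    using t by (simp add: monoD)
  have indep: "indep_vars (\<lambda>_. borel) (\<lambda>i x. \<phi> i (A (t (Suc i)) x - A (t i) x)) {..<n}"
    using t by (intro indep_vars_compose2[OF increments_indep]) auto
  have meas[measurable]: "(\<lambda>x. A (t (Suc i)) x - A (t i) x) \<in> measurable M (count_space UNIV)"
      "A (t (Suc i) - t i) \<in> measurable M (count_space UNIV)" for i
    using count_measurable[OF t_nonneg[of i]] count_measurable[OF t_nonneg[of "Suc i"]]
      count_measurable[of "t (Suc i) - t i"] t_Suc by auto
  have "(LINT x|M. (\<Prod>i<n. \<phi> i (A (t (Suc i)) x - A (t i) x)))
    = (\<Prod>i<n. (LINT x|M. \<phi> i (A (t (Suc i)) x - A (t i) x)))"
    using indep by (intro indep_vars_lebesgue_integral)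
      (auto intro!: integrable_const_bound[where B=1] simp: bound)
  also have "\<dots> = (\<Prod>i<n. (LINT x|M. \<phi> i (A (t (Suc i) - t i) x)))"
  proof (rule prod.cong)
    fix i
    have "(LINT x|M. \<phi> i (A (t (Suc i)) x - A (t i) x))
        = (LINT k|distr M (count_space UNIV) (\<lambda>x. A (t (Suc i)) x - A (t i) x). \<phi> i k)"
      by (subst integral_distr) auto
    also have "\<dots> = (LINT x|M. \<phi> i (A (t (Suc i) - t i) x))"
      unfolding distr_increment[OF t_nonneg t_Suc] by (subst integral_distr) auto
    finally show "(LINT x|M. \<phi> i (A (t (Suc i)) x - A (t i) x)) = (LINT x|M. \<phi> i (A (t (Suc i) - t i) x))" .
  qed simp
  finally show ?thesis .
qed

end

section \<open>Independence of the arrivals and the work\<close>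

context gated_vacation_queue
begin

lemmas [measurable] = service_measurable vacation_measurable

text \<open>The sigma-algebras of the arrivals and of the work (all services and vacations) are
  encoded as measure spaces on the same points, so that their independence is that of two copies of
  the identity map.\<close>

definition arrival_space :: "'a measure" where
  "arrival_space = sigma (space M) (source_events M A H V Arrivals)"

definition work_space :: "'a measure" where
  "work_space = sigma (space M) (\<Union>s\<in>- {Arrivals}. source_events M A H V s)"

lemma source_events_subset: "source_events M A H V s \<subseteq> events"
  using sources_indep unfolding indep_sets_def by auto

lemma Int_stable_source_events: "Int_stable (source_events M A H V s)"
proof (cases s)
  case Arrivals
  interpret S: sigma_algebra "space M" "source_events M A H V Arrivals"
    unfolding source_events.simps by (rule sigma_algebra_sigma_sets) auto
  show ?thesis
    using Arrivals by (auto simp: Int_stable_def simp del: source_events.simps)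
next
  case (Service i)
  have "\<exists>D. H i -` B \<inter> space M \<inter> (H i -` C \<inter> space M) = H i -` D \<inter> space M \<and> D \<in> sets borel"
    if "B \<in> sets borel" "C \<in> sets borel" for B C
    using that by (intro exI[of _ "B \<inter> C"]) auto
  then show ?thesis using Service by (auto simp: Int_stable_def)
next
  case (Vacation i)
  have "\<exists>D. V i -` B \<inter> space M \<inter> (V i -` C \<inter> space M) = V i -` D \<inter> space M \<and> D \<in> sets borel"
    if "B \<in> sets borel" "C \<in> sets borel" for B C
    using that by (intro exI[of _ "B \<inter> C"]) auto
  then show ?thesis using Vacation by (auto simp: Int_stable_def)
qed

lemma space_arrival_space [simp]: "space arrival_space = space M"
  and sets_arrival_space: "sets arrival_space = source_events M A H V Arrivals"
  and space_work_space [simp]: "space work_space = space M"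
  and sets_work_space: "sets work_space = sigma_sets (space M) (\<Union>s\<in>- {Arrivals}. source_events M A H V s)"
proof -
  have sub: "source_events M A H V s \<subseteq> Pow (space M)" for s
    using source_events_subset[of s] sets.sets_into_space by auto
  show "space arrival_space = space M" "space work_space = space M"
    unfolding arrival_space_def work_space_def by (intro space_measure_of UN_least sub)+
  have "sigma_sets (space M) (source_events M A H V Arrivals) = source_events M A H V Arrivals"
    unfolding source_events.simps by (rule sigma_sets_sigma_sets_eq) auto
  then show "sets arrival_space = source_events M A H V Arrivals"
    unfolding arrival_space_def using sub by (simp add: sets_measure_of del: source_events.simps)
  show "sets work_space = sigma_sets (space M) (\<Union>s\<in>- {Arrivals}. source_events M A H V s)"
    unfolding work_space_def by (rule sets_measure_of) (use sub in blast)
qed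

lemma count_arrival_measurable: "0 \<le> t \<Longrightarrow> A t \<in> measurable arrival_space (count_space UNIV)"
  by (rule measurableI) (auto simp: sets_arrival_space intro!: sigma_sets.Basic)

lemma service_work_measurable [measurable]: "H i \<in> measurable work_space borel"
  by (rule measurableI)
    (simp_all add: sets_work_space, intro sigma_sets.Basic UN_I[of "Service i"], auto)

lemma vacation_work_measurable [measurable]: "V i \<in> measurable work_space borel"
  by (rule measurableI)
    (simp_all add: sets_work_space, intro sigma_sets.Basic UN_I[of "Vacation i"], auto)

lemma measurable_id_arrival: "(\<lambda>x. x) \<in> measurable M arrival_space"
  using source_events_subset[of Arrivals] sets.sets_into_space
  by (intro measurableI) (auto simp: sets_arrival_space Int_absorb2 simp del: source_events.simps)

lemma measurable_id_work: "(\<lambda>x. x) \<in> measurable M work_space"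
proof -
  have sub: "source_events M A H V s \<subseteq> Pow (space M)" for s
    using source_events_subset[of s] sets.sets_into_space by auto
  show ?thesis
    unfolding work_space_def
  proof (rule measurable_measure_of)
    show "(\<Union>s\<in>- {Arrivals}. source_events M A H V s) \<subseteq> Pow (space M)"
      using sub by blast
    show "(\<lambda>x. x) -` B \<inter> space M \<in> events" if "B \<in> (\<Union>s\<in>- {Arrivals}. source_events M A H V s)" for B
      using that source_events_subset sub by (auto simp: Int_absorb2 subset_iff simp del: source_events.simps)
  qed simp
qed

text \<open>Grouping independent intersection-stable families into disjoint blocks keeps the
  generated sigma-algebras independent; the blocks are \<open>Arrivals\<close> and all other
  sources.\<close>

lemma indep_arrivals_work: "indep_var arrival_space (\<lambda>x. x) work_space (\<lambda>x. x)"
proof -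
  define I where "I b = (if b then {Arrivals} else - {Arrivals})" for b
  have "indep_sets (\<lambda>b. sigma_sets (space M) (\<Union>s\<in>I b. source_events M A H V s)) UNIV"
    by (intro indep_sets_collect_sigma indep_sets_mono_index[OF _ sources_indep] Int_stable_source_events)
      (auto simp: I_def disjoint_family_on_def)
  then have "indep_set (sigma_sets (space M) {(\<lambda>x. x) -` B \<inter> space M |B. B \<in> sets arrival_space})
      (sigma_sets (space M) {(\<lambda>x. x) -` B \<inter> space M |B. B \<in> sets work_space})"
    unfolding indep_set_def
  proof (rule indep_sets_mono_sets)
    have sub: "{(\<lambda>x. x) -` B \<inter> space M |B. B \<in> sets N} \<subseteq> sets N" if "space N = space M" for N
      using sets.sets_into_space[of _ N] that by (auto simp: Int_absorb2)
    fix b :: bool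
    show "(case b of True \<Rightarrow> sigma_sets (space M) {(\<lambda>x. x) -` B \<inter> space M |B. B \<in> sets arrival_space}
        | False \<Rightarrow> sigma_sets (space M) {(\<lambda>x. x) -` B \<inter> space M |B. B \<in> sets work_space})
      \<subseteq> sigma_sets (space M) (\<Union>s\<in>I b. source_events M A H V s)"
    proof (cases b)
      case True
      then show ?thesis
        using sub[of arrival_space]
        by (simp add: I_def sets_arrival_space sigma_sets_mono' del: source_events.simps)
    next
      case False
      then show ?thesis
        using sigma_sets_mono[OF sub[of work_space, unfolded sets_work_space]]
        by (simp add: I_def sets_work_space del: source_events.simps)
    qed
  qed
  then show ?thesis
    unfolding indep_var_eq using measurable_id_arrival measurable_id_work by simp
qed

text \<open>Freezing: since the arrivals are independent of the work, they may be integrated out first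
  with the interval lengths \<open>D\<close> held fixed.\<close>

lemma integral_random_increments:
  fixes D :: "nat \<Rightarrow> 'a \<Rightarrow> real" and \<phi> :: "nat \<Rightarrow> nat \<Rightarrow> complex" and f :: "nat \<Rightarrow> real \<Rightarrow> complex"
  assumes D[measurable]: "\<And>i. D i \<in> measurable work_space borel"
    and D_nonneg: "\<And>i x. x \<in> space M \<Longrightarrow> 0 \<le> D i x"
    and indep: "indep_vars (\<lambda>_. borel) D UNIV"
    and \<phi>: "\<And>i k. norm (\<phi> i k) \<le> 1"
    and f[measurable]: "\<And>i. f i \<in> borel_measurable borel"
    and f_le: "\<And>i d. 0 \<le> d \<Longrightarrow> norm (f i d) \<le> 1"
  defines "S \<equiv> \<lambda>i x. \<Sum>m<i. D m x"
  shows "(LINT x|M. (\<Prod>i<n. f i (D i x) * \<phi> i (A (S (Suc i) x) x - A (S i x) x)))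
    = (\<Prod>i<n. (LINT x|M. f i (D i x) * (LINT y|M. \<phi> i (A (D i x) y))))"
proof -
  let ?N = work_space
  \<comment> \<open>\<open>x\<close> carries the arrivals and \<open>y\<close> the work; the given
    integrand is \<open>F\<close> on the diagonal.\<close>
  define F where "F x y = (\<Prod>i<n. f i (D i y)
    * \<phi> i (A (max 0 (S (Suc i) y)) x - A (max 0 (S i y)) x))" for x y
  have DM[measurable]: "D i \<in> borel_measurable M" for i
    using measurable_compose[OF measurable_id_work D] by simp
  have S_nonneg: "0 \<le> S i y" if "y \<in> space M" for i y
    using D_nonneg[OF that] by (simp add: S_def sum_nonneg)
  let ?P = "distr M arrival_space (\<lambda>x. x)" and ?Q = "distr M ?N (\<lambda>x. x)"
  \<comment> \<open>By independence the diagonal map has the product law, so the integral becomes a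
    double integral.\<close>
  have joint: "?P \<Otimes>\<^sub>M ?Q = distr M (arrival_space \<Otimes>\<^sub>M ?N) (\<lambda>x. (x, x))"
    using indep_arrivals_work unfolding indep_var_distribution_eq by simp
  interpret P: prob_space ?P
    using measurable_id_arrival by (rule prob_space_distr)
  interpret Q: prob_space ?Q
    using measurable_id_work by (rule prob_space_distr)
  interpret PQ: pair_prob_space ?P ?Q ..
  note [measurable] = measurable_id_arrival measurable_id_work
  have A_meas: "(\<lambda>(x, t). A (max 0 t) x) \<in> measurable (arrival_space \<Otimes>\<^sub>M borel) (count_space UNIV)"
    by (rule measurable_right_continuous_count)
      (auto intro: count_arrival_measurable count_right_continuous)
  have A_meas'[measurable]: "(\<lambda>p. A (max 0 (S i (snd p))) (fst p)) \<in>
      measurable (arrival_space \<Otimes>\<^sub>M ?N) (count_space UNIV)" for i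
  proof -
    have "(\<lambda>p. (fst p, S i (snd p))) \<in> measurable (arrival_space \<Otimes>\<^sub>M ?N) (arrival_space \<Otimes>\<^sub>M borel)"
      unfolding S_def by measurable
    from measurable_compose[OF this A_meas] show ?thesis by simp
  qed
  have F_meas[measurable]: "(\<lambda>p. F (fst p) (snd p)) \<in> borel_measurable (arrival_space \<Otimes>\<^sub>M ?N)"
    unfolding F_def by measurable
  have F_le: "norm (F x y) \<le> 1" if "y \<in> space M" for x y
    unfolding F_def using D_nonneg[OF that]
    by (auto simp: norm_mult prod_norm[symmetric] intro!: prod_le_1 mult_le_one f_le \<phi>)
  have F_eq: "F x y = (\<Prod>i<n. f i (D i y) * \<phi> i (A (S (Suc i) y) x - A (S i y) x))"
    if "y \<in> space M" for x y
    using S_nonneg[OF that] by (simp add: F_def)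
  have "(LINT x|M. (\<Prod>i<n. f i (D i x) * \<phi> i (A (S (Suc i) x) x - A (S i x) x)))
      = (LINT x|M. (\<lambda>p. F (fst p) (snd p)) (x, x))"
    by (intro Bochner_Integration.integral_cong refl) (simp add: F_eq)
  also have "\<dots> = (LINT p|(?P \<Otimes>\<^sub>M ?Q). F (fst p) (snd p))"
    unfolding joint by (subst integral_distr) auto
  also have "\<dots> = (LINT y|?Q. (LINT x|?P. F x y))"
  proof -
    have "integrable (?P \<Otimes>\<^sub>M ?Q) (\<lambda>p. F (fst p) (snd p))"
      by (rule PQ.integrable_const_bound[where B=1]) (auto simp: F_le space_pair_measure intro!: AE_I2)
    then show ?thesis
      by (subst PQ.integral_snd) (simp_all add: case_prod_beta')
  qed
  also have "\<dots> = (LINT y|M. (LINT x|?P. F x y))"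
  proof (rule integral_distr)
    have "(\<lambda>p. F (snd p) (fst p)) \<in> borel_measurable (?N \<Otimes>\<^sub>M ?P)"
      using measurable_compose[OF measurable_pair_swap' F_meas] by (simp add: case_prod_beta' cong: measurable_cong_sets)
    then show "(\<lambda>y. (LINT x|?P. F x y)) \<in> borel_measurable ?N"
      by (intro P.borel_measurable_lebesgue_integral) (simp add: case_prod_beta')
  qed measurable
  also have "\<dots> = (LINT y|M. (\<Prod>i<n. f i (D i y) * (LINT x|M. \<phi> i (A (max 0 (D i y)) x))))"
  proof (intro Bochner_Integration.integral_cong refl)
    fix y assume y: "y \<in> space M"
    have [measurable]: "(\<lambda>x. F x y) \<in> borel_measurable arrival_space"
      using measurable_compose[OF measurable_Pair2' F_meas] y by simp
    have "(LINT x|?P. F x y) = (LINT x|M. F x y)"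
      by (subst integral_distr) auto
    also have "\<dots> = (LINT x|M. (\<Prod>i<n. f i (D i y)) * (\<Prod>i<n. \<phi> i (A (S (Suc i) y) x - A (S i y) x)))"
      using y by (intro Bochner_Integration.integral_cong refl) (simp add: F_eq prod.distrib)
    also have "\<dots> = (\<Prod>i<n. f i (D i y)) * (\<Prod>i<n. (LINT x|M. \<phi> i (A (S (Suc i) y - S i y) x)))"
    proof -
      \<comment> \<open>For fixed \<open>y\<close> the epochs are deterministic and nondecreasing,
        so independence of the increments applies.\<close>
      have "mono (\<lambda>i. S i y)"
        unfolding S_def using D_nonneg[OF y] by (intro monoI sum_mono2) auto
      then show ?thesis
        using \<phi> by (subst integral_mult_right_zero, subst integral_prod_increments) (auto simp: S_def)
    qed
    also have "\<dots> = (\<Prod>i<n. f i (D i y) * (LINT x|M. \<phi> i (A (max 0 (D i y)) x)))"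
      using D_nonneg[OF y] by (simp add: prod.distrib S_def)
    finally show "(LINT x|?P. F x y) = (\<Prod>i<n. f i (D i y) * (LINT x|M. \<phi> i (A (max 0 (D i y)) x)))" .
  qed
  \<comment> \<open>Each factor now depends on \<open>D i\<close> alone, and the \<open>D i\<close>
    are independent.\<close>
  also have "\<dots> = (\<Prod>i<n. (LINT y|M. f i (D i y) * (LINT x|M. \<phi> i (A (max 0 (D i y)) x))))"
  proof (rule indep_vars_lebesgue_integral)
    have \<Phi>[measurable]: "(\<lambda>d. (LINT x|M. \<phi> i (A (max 0 d) x))) \<in> borel_measurable borel" for i
    proof (rule borel_measurable_lebesgue_integral)
      have "(\<lambda>p. (snd p, fst p)) \<in> measurable (borel \<Otimes>\<^sub>M M) (M \<Otimes>\<^sub>M (borel :: real measure))"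
        by measurable
      from measurable_compose[OF this count_joint_measurable]
      show "(\<lambda>(d, x). \<phi> i (A (max 0 d) x)) \<in> borel_measurable (borel \<Otimes>\<^sub>M M)"
        by (simp add: case_prod_beta' )
    qed
    show "indep_vars (\<lambda>_. borel) (\<lambda>i y. f i (D i y) * (LINT x|M. \<phi> i (A (max 0 (D i y)) x))) {..<n}"
      by (rule indep_vars_compose2[OF indep_vars_subset[OF indep],
            where Y="\<lambda>i d. f i d * (LINT x|M. \<phi> i (A (max 0 d) x))"]) auto
    fix i
    show "integrable M (\<lambda>y. f i (D i y) * (LINT x|M. \<phi> i (A (max 0 (D i y)) x)))"
    proof (rule integrable_const_bound[where B=1])
      have "norm (LINT x|M. \<phi> i (A (max 0 d) x)) \<le> 1" for d
      proof -
        have [measurable]: "A (max 0 d) \<in> measurable M (count_space UNIV)"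
          by (rule count_measurable) simp
        have "norm (LINT x|M. \<phi> i (A (max 0 d) x)) \<le> (LINT x|M. 1)"
          by (rule norm_integral_le) (auto simp: \<phi> intro!: integrable_const_bound[where B=1])
        then show ?thesis by (simp add: prob_space)
      qed
      then show "AE y in M. norm (f i (D i y) * (LINT x|M. \<phi> i (A (max 0 (D i y)) x))) \<le> 1"
        using D_nonneg unfolding norm_mult by (intro AE_I2 mult_le_one f_le norm_ge_zero)
    qed measurable
  qed simp
  also have "\<dots> = (\<Prod>i<n. (LINT x|M. f i (D i x) * (LINT y|M. \<phi> i (A (D i x) y))))"
    using D_nonneg by (intro prod.cong refl Bochner_Integration.integral_cong) simp_all
  finally show ?thesis .
qed

end

section \<open>The queue at the ends of the vacations\<close>

lemma integral_partition_sums: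
  fixes Z :: "'a \<Rightarrow> 'b::{banach, second_countable_topology, real_normed_algebra_1}" and \<tau> :: "'a \<Rightarrow> nat"
  assumes \<tau>[measurable]: "\<tau> \<in> measurable M (count_space UNIV)" and Z: "integrable M Z"
  shows "(\<lambda>i. LINT x|M. of_bool (\<tau> x = i) * Z x) sums (LINT x|M. Z x)"
proof -
  have [measurable]: "Z \<in> borel_measurable M" using Z by simp
  have int: "integrable M (\<lambda>x. of_bool (\<tau> x = i) * Z x)" for i
    by (rule Bochner_Integration.integrable_bound[OF Z]) auto
  have "(\<Sum>i<N. LINT x|M. of_bool (\<tau> x = i) * Z x) = (LINT x|M. of_bool (\<tau> x < N) * Z x)" for N
  proof -
    have "(\<Sum>i<N. LINT x|M. of_bool (\<tau> x = i) * Z x) = (LINT x|M. (\<Sum>i<N. of_bool (\<tau> x = i) * Z x))"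
      by (rule Bochner_Integration.integral_sum[symmetric]) (rule int)
    also have "\<dots> = (LINT x|M. of_bool (\<tau> x < N) * Z x)"
      by (intro Bochner_Integration.integral_cong refl) (simp flip: sum_distrib_right)
    finally show ?thesis .
  qed
  moreover have "(\<lambda>N. LINT x|M. of_bool (\<tau> x < N) * Z x) \<longlonglongrightarrow> (LINT x|M. Z x)"
  proof (rule integral_dominated_convergence[where w="\<lambda>x. norm (Z x)"])
    show "AE x in M. (\<lambda>N. of_bool (\<tau> x < N) * Z x) \<longlonglongrightarrow> Z x"
    proof (intro AE_I2 tendsto_eventually)
      fix x show "\<forall>\<^sub>F N in sequentially. of_bool (\<tau> x < N) * Z x = Z x"
        using eventually_gt_at_top[of "\<tau> x"] by eventually_elim simp
    qed
  qed (use Z in auto)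
  ultimately show ?thesis by (simp add: sums_def)
qed

text \<open>Equality on the atoms of a countable partition passes to every union of atoms.
  \<open>to_nat\<close> indexes the atoms by numbers; numbers that code no value contribute
  zero.\<close>

lemma integral_eq_on_countable_partition:
  fixes Z W :: "'a \<Rightarrow> complex" and X :: "'a \<Rightarrow> 'b::countable"
  assumes X[measurable]: "X \<in> measurable M (count_space UNIV)"
    and Z: "integrable M Z" and W: "integrable M W"
    and eq: "\<And>b. (LINT x|M. of_bool (X x = b) * Z x) = (LINT x|M. of_bool (X x = b) * W x)"
  shows "(LINT x|M. of_bool (P (X x)) * Z x) = (LINT x|M. of_bool (P (X x)) * W x)"
proof -
  have [measurable]: "(\<lambda>x. to_nat (X x)) \<in> measurable M (count_space UNIV)"
    by measurable
  have "(\<lambda>i. LINT x|M. of_bool (to_nat (X x) = i) * (of_bool (P (X x)) * U x))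
      = (\<lambda>i. if P (from_nat i) \<and> to_nat (from_nat i :: 'b) = i
          then (LINT x|M. of_bool (X x = from_nat i) * U x) else 0)"
    for U :: "'a \<Rightarrow> complex"
  proof
    fix i
    have "(LINT x|M. of_bool (to_nat (X x) = i) * (of_bool (P (X x)) * U x))
        = (LINT x|M. of_bool (P (from_nat i) \<and> to_nat (from_nat i :: 'b) = i) * (of_bool (X x = from_nat i) * U x))"
      by (intro Bochner_Integration.integral_cong refl) auto
    then show "(LINT x|M. of_bool (to_nat (X x) = i) * (of_bool (P (X x)) * U x))
      = (if P (from_nat i) \<and> to_nat (from_nat i :: 'b) = i
          then (LINT x|M. of_bool (X x = from_nat i) * U x) else 0)"
      by simp
  qed
  note * = this
  have int: "integrable M (\<lambda>x. of_bool (P (X x)) * U x)" if "integrable M U" for U :: "'a \<Rightarrow> complex"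
  proof -
    have [measurable]: "U \<in> borel_measurable M" using that by simp
    show ?thesis by (rule Bochner_Integration.integrable_bound[OF that]) auto
  qed
  show ?thesis
    using integral_partition_sums[OF \<open>(\<lambda>x. to_nat (X x)) \<in> _\<close> int[OF Z]]
      integral_partition_sums[OF \<open>(\<lambda>x. to_nat (X x)) \<in> _\<close> int[OF W]]
    unfolding * eq by (rule sums_unique2)
qed

section \<open>Period lengths on a prescribed path, and measurability of the epochs\<close>

context gated_vacation_queue
begin

text \<open>One family for services and vacations, so that blocks mixing both kinds can be selected.
  The value at \<open>Arrivals\<close> is a dummy outside the index set in use.\<close>

definition source_value :: "source \<Rightarrow> 'a \<Rightarrow> real" where
  "source_value s x = (case s of Arrivals \<Rightarrow> 0 | Service i \<Rightarrow> H i x | Vacation i \<Rightarrow> V i x)"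

lemma source_value_simps [simp]:
  "source_value (Service i) = H i" "source_value (Vacation i) = V i"
  by (simp_all add: source_value_def fun_eq_iff)

lemma indep_source_value: "indep_vars (\<lambda>_. borel) source_value (- {Arrivals})"
  unfolding indep_vars_def2
proof
  show "\<forall>s\<in>- {Arrivals}. random_variable borel (source_value s)"
  proof
    fix s assume "s \<in> - {Arrivals}"
    then show "random_variable borel (source_value s)" by (cases s) auto
  qed
  show "indep_sets (\<lambda>s. {source_value s -` B \<inter> space M |B. B \<in> sets borel}) (- {Arrivals})"
  proof (rule indep_sets_mono[OF sources_indep])
    fix s assume "s \<in> - {Arrivals}"
    then show "{source_value s -` B \<inter> space M |B. B \<in> sets borel} \<subseteq> source_events M A H V s"
      by (cases s) auto
  qed simp
qed

definition period_length :: "(nat \<Rightarrow> nat) \<Rightarrow> nat \<Rightarrow> 'a \<Rightarrow> real" where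
  "period_length k n x = period k (\<lambda>i. H i x) (\<lambda>i. V i x) n"

definition period_sources :: "(nat \<Rightarrow> nat) \<Rightarrow> nat \<Rightarrow> source set" where
  "period_sources k n = insert (Vacation n) (Service ` {gate k n..<gate k (Suc n)})"

lemma finite_period_sources [simp]: "finite (period_sources k n)"
  by (simp add: period_sources_def)

lemma period_sources_subset: "period_sources k n \<subseteq> - {Arrivals}"
  by (auto simp: period_sources_def)

lemma prod_period_sources:
  "(\<Prod>s\<in>period_sources k n. g s) = g (Vacation n) * (\<Prod>i=gate k n..<gate k (Suc n). g (Service i))"
  unfolding period_sources_def by (subst prod.insert) (auto simp: prod.reindex inj_on_def)

lemma period_length_eq: "period_length k n x = (\<Sum>s\<in>period_sources k n. source_value s x)"
proof -
  have "(\<Sum>s\<in>period_sources k n. source_value s x)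
      = V n x + (\<Sum>i=gate k n..<gate k (Suc n). H i x)"
    unfolding period_sources_def by (subst sum.insert) (auto simp: sum.reindex inj_on_def)
  then show ?thesis by (simp add: period_length_def period_def)
qed

lemma period_length_nonneg: "x \<in> space M \<Longrightarrow> 0 \<le> period_length k n x"
  unfolding period_length_def period_def
  by (intro add_nonneg_nonneg sum_nonneg service_nonneg vacation_nonneg)

lemma period_length_measurable [measurable]:
  "period_length k n \<in> measurable work_space borel" "period_length k n \<in> borel_measurable M"
  unfolding period_length_def[abs_def] period_def by measurable

lemma gate_le: "m \<le> n \<Longrightarrow> gate k m \<le> gate k n"
  unfolding gate_def by (intro sum_mono2) auto

text \<open>Since \<open>gate k\<close> is monotone, different periods draw on disjoint blocks of
  sources. This relies on \<open>k\<close> being fixed: on a random path the blocks would themselves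
  be random.\<close>

lemma indep_period_length: "indep_vars (\<lambda>_. borel) (period_length k) UNIV"
proof -
  have "disjoint_family_on (period_sources k) UNIV"
    unfolding disjoint_family_on_def
  proof (intro ballI impI)
    fix m n :: nat assume "m \<noteq> n"
    then consider "Suc m \<le> n" | "Suc n \<le> m" by linarith
    then show "period_sources k m \<inter> period_sources k n = {}"
      using \<open>m \<noteq> n\<close> by cases (auto simp: period_sources_def dest: gate_le[of _ _ k])
  qed
  then have "indep_vars (\<lambda>n. PiM (period_sources k n) (\<lambda>_. borel))
      (\<lambda>n x. restrict (\<lambda>s. source_value s x) (period_sources k n)) UNIV"
    using period_sources_subset by (intro indep_vars_restrict[OF indep_source_value]) auto
  then have "indep_vars (\<lambda>_. borel)
      (\<lambda>n x. \<Sum>s\<in>period_sources k n. restrict (\<lambda>s. source_value s x) (period_sources k n) s) UNIV"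
    by (rule indep_vars_compose2[where Y="\<lambda>n f. \<Sum>s\<in>period_sources k n. f s"]) measurable
  then show ?thesis
    by (simp add: period_length_eq[abs_def])
qed

lemma integral_exp_period_length:
  assumes s: "0 \<le> Re s"
  shows "(LINT x|M. exp (- s * of_real (period_length k n x))) = lst vacation_law s * lst service_law s ^ k n"
proof -
  have "(LINT x|M. exp (- s * of_real (period_length k n x)))
      = (LINT x|M. (\<Prod>r\<in>period_sources k n. exp (- s * of_real (source_value r x))))"
    by (simp add: period_length_eq sum_distrib_left exp_sum flip: sum_negf)
  also have "\<dots> = (\<Prod>r\<in>period_sources k n. (LINT x|M. exp (- s * of_real (source_value r x))))"
  proof (rule indep_vars_lebesgue_integral)
    show "indep_vars (\<lambda>_. borel) (\<lambda>r x. exp (- s * of_real (source_value r x))) (period_sources k n)"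
      by (rule indep_vars_compose2[OF indep_vars_subset[OF indep_source_value period_sources_subset],
            where Y="\<lambda>_ y. exp (- s * of_real y)"]) measurable
    fix r assume "r \<in> period_sources k n"
    then show "integrable M (\<lambda>x. exp (- s * of_real (source_value r x)))"
      using integrable_exp_neg[OF service_measurable service_nonneg s]
        integrable_exp_neg[OF vacation_measurable vacation_nonneg s]
      by (auto simp: period_sources_def)
  qed simp
  also have "\<dots> = lst vacation_law s * lst service_law s ^ k n"
    using lst_distr[OF service_measurable service_nonneg, of _ s]
      lst_distr[OF vacation_measurable vacation_nonneg, of n s]
    by (simp add: prod_period_sources service_distr vacation_distr gate_def)
  finally show ?thesis .
qed

definition epoch :: "nat \<Rightarrow> nat \<Rightarrow> 'a \<Rightarrow> real" where
  "epoch c n x = fst (chain c (\<lambda>t. A t x) (\<lambda>i. H i x) (\<lambda>i. V i x) n)"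

definition served :: "nat \<Rightarrow> nat \<Rightarrow> 'a \<Rightarrow> nat" where
  "served c n x = snd (chain c (\<lambda>t. A t x) (\<lambda>i. H i x) (\<lambda>i. V i x) n)"

text \<open>The epoch is the last argument so that \<open>present c x\<close> is a whole
  path.\<close>

definition present :: "nat \<Rightarrow> 'a \<Rightarrow> nat \<Rightarrow> nat" where
  "present c x n = queue c (\<lambda>t. A t x) (\<lambda>i. H i x) (\<lambda>i. V i x) n"

lemma epoch_0 [simp]: "epoch c 0 x = 0" and served_0 [simp]: "served c 0 x = 0"
  by (simp_all add: epoch_def served_def)

lemma present_0 [simp]: "x \<in> space M \<Longrightarrow> present c x 0 = c"
  by (simp add: present_def queue_def count_zero)

lemma epoch_nonneg: "x \<in> space M \<Longrightarrow> 0 \<le> epoch c n x"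
  unfolding epoch_def
  by (rule chain_time_nonneg) (auto intro: count_zero count_mono service_nonneg vacation_nonneg)

lemma chain_measurable:
  shows epoch_measurable [measurable]: "epoch c n \<in> borel_measurable M"
    and served_measurable [measurable]: "served c n \<in> measurable M (count_space UNIV)"
    and present_measurable [measurable]: "(\<lambda>x. present c x n) \<in> measurable M (count_space UNIV)"
proof -
  have present: "(\<lambda>x. present c x n) \<in> measurable M (count_space UNIV)"
    if [measurable]: "epoch c n \<in> borel_measurable M" "served c n \<in> measurable M (count_space UNIV)" for n
  proof -
    have [measurable]: "(\<lambda>x. A (epoch c n x) x) \<in> measurable M (count_space UNIV)"
      by (rule count_at_measurable) (auto intro: epoch_nonneg)
    have "(\<lambda>x. present c x n) = (\<lambda>x. c + A (epoch c n x) x - served c n x)"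
      by (simp add: present_def queue_def epoch_def served_def fun_eq_iff)
    then show ?thesis by simp
  qed
  have "epoch c n \<in> borel_measurable M \<and> served c n \<in> measurable M (count_space UNIV)"
  proof (induction n)
    case 0
    have "epoch c 0 = (\<lambda>x. 0)" "served c 0 = (\<lambda>x. 0)" by auto
    then show ?case by simp
  next
    case (Suc n)
    then have [measurable]: "epoch c n \<in> borel_measurable M" "served c n \<in> measurable M (count_space UNIV)"
        "(\<lambda>x. present c x n) \<in> measurable M (count_space UNIV)"
      using present by auto
    \<comment> \<open>Both ends of the summation range are random, so measurability is obtained by
      splitting over their countably many values.\<close>
    have "(\<lambda>x. sum (\<lambda>i. H i x) {served c n x..<served c n x + present c x n}) \<in> borel_measurable M"
      by (rule measurable_compose_countable[where g="served c n"
            and f="\<lambda>j x. sum (\<lambda>i. H i x) {j..<j + present c x n}"])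
        (rule measurable_compose_countable[where g="\<lambda>x. present c x n"
            and f="\<lambda>l x. sum (\<lambda>i. H i x) {j..<j + l}" for j], measurable)
    then have "(\<lambda>x. epoch c n x + sum (\<lambda>i. H i x) {served c n x..<served c n x + present c x n} + V n x)
        \<in> borel_measurable M"
      by measurable
    moreover have "epoch c (Suc n) = (\<lambda>x. epoch c n x
        + sum (\<lambda>i. H i x) {served c n x..<served c n x + present c x n} + V n x)"
      "served c (Suc n) = (\<lambda>x. served c n x + present c x n)"
      by (simp_all add: epoch_def served_def present_def chain_Suc fun_eq_iff del: chain.simps(2))
    ultimately show ?case by simp
  qed
  then show "epoch c n \<in> borel_measurable M" "served c n \<in> measurable M (count_space UNIV)"
      "(\<lambda>x. present c x n) \<in> measurable M (count_space UNIV)"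
    using present by auto
qed

text \<open>A finite list, unlike an infinite path, has only countably many values, as the partition
  argument requires.\<close>

lemma countable_path_measurable:
  "(\<lambda>x. map (present c x) [0..<n]) \<in> measurable M (count_space UNIV)"
proof (subst measurable_count_space_eq2_countable, intro conjI ballI)
  fix b :: "nat list"
  have [measurable]: "{x \<in> space M. present c x i = j} \<in> events" for i j
    using present_measurable[of c i] by simp
  have "{x \<in> space M. \<forall>i\<in>{..<n}. present c x i = b ! i} \<in> events"
    by (rule sets.sets_Collect_finite_All) (auto)
  moreover have "map (present c x) [0..<n] = b \<longleftrightarrow> length b = n \<and> (\<forall>i\<in>{..<n}. present c x i = b ! i)" for x
    by (auto simp add: list_eq_iff_nth_eq)
  then have "(\<lambda>x. map (present c x) [0..<n]) -` {b} \<inter> space M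
      = (if length b = n then {x \<in> space M. \<forall>i\<in>{..<n}. present c x i = b ! i} else {})"
    by (simp only: vimage_def singleton_iff) auto
  ultimately show "(\<lambda>x. map (present c x) [0..<n]) -` {b} \<inter> space M \<in> events" by simp
qed simp_all

end

section \<open>One-step recursion for the joint transforms\<close>

locale gated_vacation_transform = gated_vacation_queue M rate A service_law vacation_law H V
  for M :: "'a measure" and rate A service_law vacation_law H V +
  fixes z \<omega> :: complex
  assumes z: "cmod z \<le> 1" and \<omega>: "0 \<le> Re \<omega>"
begin

definition weight :: "nat \<Rightarrow> nat \<Rightarrow> 'a \<Rightarrow> complex" where
  "weight c n x = z ^ served c n x * exp (- \<omega> * of_real (epoch c n x))"

lemma weight_measurable [measurable]: "weight c n \<in> borel_measurable M"
  unfolding weight_def[abs_def] by measurable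

lemma norm_weight_le:
  assumes "x \<in> space M"
  shows "norm (weight c n x) \<le> 1"
proof -
  have "norm (exp (- \<omega> * of_real (epoch c n x))) \<le> 1"
    using \<omega> epoch_nonneg[OF assms] by simp
  then show ?thesis
    unfolding weight_def norm_mult norm_power
    by (intro mult_le_one power_le_one z norm_ge_zero zero_le_power)
qed

text \<open>The transforms are controlled for arguments in the right half-plane. The first bound
  measures the distance from its boundary, for geometric decay of the products.\<close>

lemma Re_psi_argument:
  assumes "norm u \<le> 1"
  shows "Re \<omega> + rate * (1 - norm u) \<le> Re (\<omega> + of_real rate - of_real rate * u)"
    and "0 \<le> Re (\<omega> + of_real rate - of_real rate * u)"
proof -
  have "rate * Re u \<le> rate * norm u"
    using rate_pos complex_Re_le_cmod by (simp add: mult_left_mono)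
  then show "Re \<omega> + rate * (1 - norm u) \<le> Re (\<omega> + of_real rate - of_real rate * u)"
    by (simp add: right_diff_distrib)
  moreover have "0 \<le> Re \<omega> + rate * (1 - norm u)"
    using assms \<omega> rate_pos by simp
  ultimately show "0 \<le> Re (\<omega> + of_real rate - of_real rate * u)" by linarith
qed

lemma norm_psi_H_le: "norm u \<le> 1 \<Longrightarrow> norm (psi_H service_law rate n z \<omega> u) \<le> 1"
proof (induction n)
  case (Suc n)
  let ?s = "\<omega> + of_real rate - of_real rate * psi_H service_law rate n z \<omega> u"
  have "0 \<le> Re ?s"
    using Suc.IH[OF Suc.prems] by (rule Re_psi_argument)
  then have "norm (lst service_law ?s) \<le> 1"
    using norm_lst_le[OF service_measurable service_nonneg, of ?s 0] by (simp add: service_distr)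
  then show ?case
    using z by (simp add: norm_mult mult_le_one)
qed simp

text \<open>On a prescribed path both sides are products of integrals over the periods, and they differ
  only in the factor of the last one.\<close>

lemma path_step:
  fixes u :: complex and k :: "nat \<Rightarrow> nat" and c n :: nat
  assumes u: "norm u \<le> 1"
  defines "p \<equiv> \<lambda>x. of_bool (\<forall>i\<le>n. present c x i = k i) :: complex"
  shows "(LINT x|M. p x * (weight c (Suc n) x * u ^ present c x (Suc n)))
    = psi_V service_law vacation_law rate 1 z \<omega> u
      * (LINT x|M. p x * (weight c n x * psi_H service_law rate 1 z \<omega> u ^ present c x n))"
\<comment> \<open>The queue length at epoch 0 is \<open>c\<close>, so any other prescription
  describes an empty event.\<close>
proof (cases "k 0 = c")
  case False
  then have "p x = 0" if "x \<in> space M" for x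
    using that by (auto simp: p_def)
  then have "(LINT x|M. p x * g x) = (LINT x|M. 0)" for g
    by (intro Bochner_Integration.integral_cong) auto
  then show ?thesis by simp
next
  case k0: True
  let ?D = "period_length k" and ?s = "\<omega> + of_real rate - of_real rate * u"
  define S where "S i x = (\<Sum>m<i. ?D m x)" for i x
  \<comment> \<open>The first \<open>n\<close> increments are tested against the prescribed lengths;
    the increment over period \<open>n\<close> is left free and weighted by powers of
    \<open>u\<close>.\<close>
  define \<phi> :: "nat \<Rightarrow> nat \<Rightarrow> complex"
    where "\<phi> i l = (if i = n then u ^ l else of_bool (l = k (Suc i)))" for i l
  define f where "f d = exp (- \<omega> * of_real d)" for d :: real
  have S_eq: "S i x = sum (period k (\<lambda>i. H i x) (\<lambda>i. V i x)) {..<i}" for i x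
    by (simp add: S_def period_length_def)
  have increments: "(LINT x|M. (\<Prod>i<m. f (?D i x) * \<phi> i (A (S (Suc i) x) x - A (S i x) x)))
      = (\<Prod>i<m. (LINT x|M. f (?D i x) * (LINT y|M. \<phi> i (A (?D i x) y))))" for m
    unfolding S_def
  proof (rule integral_random_increments)
    show "norm (f d) \<le> 1" if "0 \<le> d" for d
      using that \<omega> by (simp add: f_def)
    show "norm (\<phi> i l) \<le> 1" for i l
      using u by (simp add: \<phi>_def norm_power power_le_one)
    show "f \<in> borel_measurable borel"
      unfolding f_def by measurable
  qed (auto intro: period_length_nonneg indep_period_length)
  have on_path: "p x = (\<Prod>i<n. of_bool (A (S (Suc i) x) x - A (S i x) x = k (Suc i)))" if x: "x \<in> space M" for x
  proof -
    have "(\<forall>i\<le>n. present c x i = k i) \<longleftrightarrow> (\<forall>i<n. A (S (Suc i) x) x - A (S i x) x = k (Suc i))"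
      unfolding present_def S_eq
      using x k0 by (intro path_iff count_zero count_mono service_nonneg vacation_nonneg)
    moreover have "(\<Prod>i<n. of_bool (Q i)) = (of_bool (\<forall>i<n. Q i) :: complex)" for Q
      by (induction n) (auto simp: less_Suc_eq)
    ultimately show "p x = (\<Prod>i<n. of_bool (A (S (Suc i) x) x - A (S i x) x = k (Suc i)))"
      by (simp add: p_def)
  qed
  have chain: "epoch c m x = S m x" "served c m x = gate k m" if "\<forall>i\<le>n. present c x i = k i" "m \<le> Suc n" for m x
    using chain_on_path[of m c "\<lambda>t. A t x" "\<lambda>i. H i x" "\<lambda>i. V i x" k] that
    by (simp_all add: present_def epoch_def served_def S_eq)
  have exp_S: "exp (- \<omega> * of_real (S m x)) = (\<Prod>i<m. f (?D i x))" for m x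
    by (simp add: S_def f_def sum_distrib_left exp_sum flip: sum_negf)
  have prod_\<phi>: "(\<Prod>i<n. \<phi> i (g i)) = (\<Prod>i<n. of_bool (g i = k (Suc i)))" for g
    by (intro prod.cong) (auto simp: \<phi>_def)
  have \<phi>_last: "\<phi> n l = u ^ l" for l
    by (simp add: \<phi>_def)
  have "(LINT x|M. p x * (weight c (Suc n) x * u ^ present c x (Suc n)))
      = (LINT x|M. z ^ gate k (Suc n) * (\<Prod>i<Suc n. f (?D i x) * \<phi> i (A (S (Suc i) x) x - A (S i x) x)))"
  proof (intro Bochner_Integration.integral_cong refl)
    fix x assume x: "x \<in> space M"
    have "present c x (Suc n) = A (S (Suc n) x) x - A (S n x) x" if "\<forall>i\<le>n. present c x i = k i"
    proof -
      have "present c x (Suc n) = A (epoch c (Suc n) x) x - A (epoch c n x) x"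
        unfolding present_def epoch_def
        using x by (intro queue_Suc count_zero count_mono service_nonneg vacation_nonneg)
      then show ?thesis using chain[OF that] by simp
    qed
    then have "p x * (weight c (Suc n) x * u ^ present c x (Suc n))
        = p x * (z ^ gate k (Suc n) * exp (- \<omega> * of_real (S (Suc n) x)) * u ^ (A (S (Suc n) x) x - A (S n x) x))"
      using chain[of x "Suc n"]
      by (cases "\<forall>i\<le>n. present c x i = k i") (simp_all add: p_def weight_def)
    also have "\<dots> = z ^ gate k (Suc n) * (\<Prod>i<Suc n. f (?D i x) * \<phi> i (A (S (Suc i) x) x - A (S i x) x))"
      unfolding exp_S on_path[OF x]
      by (simp only: prod.lessThan_Suc prod.distrib prod_\<phi> \<phi>_last mult_ac)
    finally show "p x * (weight c (Suc n) x * u ^ present c x (Suc n))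
      = z ^ gate k (Suc n) * (\<Prod>i<Suc n. f (?D i x) * \<phi> i (A (S (Suc i) x) x - A (S i x) x))" .
  qed
  \<comment> \<open>For a period of length \<open>d\<close>, the Poisson generating function times
    \<open>exp (- \<omega> * d)\<close> is \<open>exp (- ?s * d)\<close>, which produces the
    transforms at \<open>?s\<close>.\<close>
  also have "\<dots> = z ^ gate k (Suc n) * (\<Prod>i<n. (LINT x|M. f (?D i x) * (LINT y|M. \<phi> i (A (?D i x) y))))
      * (lst vacation_law ?s * lst service_law ?s ^ k n)"
  proof -
    have "(LINT x|M. f (?D n x) * (LINT y|M. \<phi> n (A (?D n x) y)))
        = (LINT x|M. exp (- ?s * of_real (?D n x)))"
    proof (intro Bochner_Integration.integral_cong refl)
      fix x assume "x \<in> space M"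
      then have "(LINT y|M. \<phi> n (A (?D n x) y)) = exp (- of_real (rate * ?D n x) * (1 - u))"
        by (simp add: \<phi>_def pgf_count period_length_nonneg)
      then show "f (?D n x) * (LINT y|M. \<phi> n (A (?D n x) y)) = exp (- ?s * of_real (?D n x))"
        by (simp add: f_def algebra_simps flip: exp_add)
    qed
    then show ?thesis
      using integral_exp_period_length[OF Re_psi_argument(2)[OF u]]
      by (subst integral_mult_right_zero, subst increments) simp
  qed
  \<comment> \<open>The batch contributes \<open>z ^ k n\<close>, which joins the power of the
    service transform to form the power of \<open>psi_H\<close>. The remaining factors fold back
    into one integral over \<open>n\<close> periods.\<close>
  also have "\<dots> = psi_V service_law vacation_law rate 1 z \<omega> u
      * (LINT x|M. (z ^ gate k n * psi_H service_law rate 1 z \<omega> u ^ k n)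
        * (\<Prod>i<n. f (?D i x) * \<phi> i (A (S (Suc i) x) x - A (S i x) x)))"
    by (subst integral_mult_right_zero, subst increments)
      (simp add: psi_V_def power_mult_distrib power_add gate_def)
  also have "(LINT x|M. (z ^ gate k n * psi_H service_law rate 1 z \<omega> u ^ k n)
        * (\<Prod>i<n. f (?D i x) * \<phi> i (A (S (Suc i) x) x - A (S i x) x)))
      = (LINT x|M. p x * (weight c n x * psi_H service_law rate 1 z \<omega> u ^ present c x n))"
  proof (intro Bochner_Integration.integral_cong refl)
    fix x assume x: "x \<in> space M"
    have "p x * (weight c n x * psi_H service_law rate 1 z \<omega> u ^ present c x n)
        = p x * (z ^ gate k n * exp (- \<omega> * of_real (S n x)) * psi_H service_law rate 1 z \<omega> u ^ k n)"
      using chain[of x n]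
      by (cases "\<forall>i\<le>n. present c x i = k i") (simp_all add: p_def weight_def)
    also have "\<dots> = (z ^ gate k n * psi_H service_law rate 1 z \<omega> u ^ k n)
        * (\<Prod>i<n. f (?D i x) * \<phi> i (A (S (Suc i) x) x - A (S i x) x))"
      unfolding exp_S on_path[OF x]
      by (simp only: prod.distrib prod_\<phi> mult_ac)
    finally show "(z ^ gate k n * psi_H service_law rate 1 z \<omega> u ^ k n)
        * (\<Prod>i<n. f (?D i x) * \<phi> i (A (S (Suc i) x) x - A (S i x) x))
      = p x * (weight c n x * psi_H service_law rate 1 z \<omega> u ^ present c x n)" by simp
  qed
  finally show ?thesis .
qed

lemma integrable_weight:
  assumes "norm u \<le> 1"
  shows "integrable M (\<lambda>x. weight c n x * u ^ present c x m)"
  using assms norm_weight_le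
  by (intro integrable_const_bound[where B=1])
    (auto simp: norm_mult norm_power intro!: mult_le_one power_le_one)

text \<open>The Markov property: \<open>Q\<close> is an event that is determined by the queue lengths at the first
  \<open>n\<close> epochs.\<close>

lemma event_step:
  assumes u: "norm u \<le> 1" and Q: "\<And>k k'. (\<And>i. i \<le> n \<Longrightarrow> k i = k' i) \<Longrightarrow> Q k = Q k'"
  shows "(LINT x|M. of_bool (Q (present c x)) * (weight c (Suc n) x * u ^ present c x (Suc n)))
    = psi_V service_law vacation_law rate 1 z \<omega> u
      * (LINT x|M. of_bool (Q (present c x)) * (weight c n x * psi_H service_law rate 1 z \<omega> u ^ present c x n))"
proof -
  let ?v = "psi_V service_law vacation_law rate 1 z \<omega> u"
  let ?W = "\<lambda>x. weight c n x * psi_H service_law rate 1 z \<omega> u ^ present c x n"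
  let ?X = "\<lambda>x. map (present c x) [0..<Suc n]"
  have "Q (present c x) = Q (\<lambda>i. ?X x ! i)" for x
    by (rule Q) (simp del: upt_Suc)
  moreover have "(LINT x|M. of_bool (Q (\<lambda>i. ?X x ! i)) * (weight c (Suc n) x * u ^ present c x (Suc n)))
      = (LINT x|M. of_bool (Q (\<lambda>i. ?X x ! i)) * (?v * ?W x))"
  proof (rule integral_eq_on_countable_partition[OF countable_path_measurable, where P="\<lambda>l. Q (\<lambda>i. l ! i)"])
    show "integrable M (\<lambda>x. weight c (Suc n) x * u ^ present c x (Suc n))"
      using u by (rule integrable_weight)
    show "integrable M (\<lambda>x. ?v * ?W x)"
      using norm_psi_H_le[OF u] by (intro integrable_mult_right integrable_weight)
    fix b
    have X: "of_bool (?X x = b) = of_bool (length b = Suc n) * (of_bool (\<forall>i\<le>n. present c x i = b ! i) :: complex)" for x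
      by (auto simp: list_eq_iff_nth_eq less_Suc_eq_le simp del: upt_Suc)
    show "(LINT x|M. of_bool (?X x = b) * (weight c (Suc n) x * u ^ present c x (Suc n)))
        = (LINT x|M. of_bool (?X x = b) * (?v * ?W x))"
      using path_step[OF u, of n c "\<lambda>i. b ! i"] unfolding X mult.assoc mult.left_commute[of _ ?v]
      by (subst (1 2) integral_mult_right_zero) (simp add: mult.left_commute[of ?v])
  qed
  ultimately show ?thesis
    unfolding mult.left_commute[of _ ?v] by (simp del: upt_Suc)
qed

text \<open>Steps are removed from the end: each replaces \<open>u\<close> by its image under the
  one-step map, and an event decided by epoch \<open>n\<close> is also decided by epoch
  \<open>n + m\<close>.\<close>

lemma event_steps:
  assumes u: "norm u \<le> 1" and Q: "\<And>k k'. (\<And>i. i \<le> n \<Longrightarrow> k i = k' i) \<Longrightarrow> Q k = Q k'"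
  shows "(LINT x|M. of_bool (Q (present c x)) * (weight c (n + m) x * u ^ present c x (n + m)))
    = (\<Prod>r = 1..m. psi_V service_law vacation_law rate r z \<omega> u)
      * (LINT x|M. of_bool (Q (present c x)) * (weight c n x * psi_H service_law rate m z \<omega> u ^ present c x n))"
  using u
proof (induction m arbitrary: u)
  case (Suc m)
  have "(LINT x|M. of_bool (Q (present c x)) * (weight c (n + Suc m) x * u ^ present c x (n + Suc m)))
      = psi_V service_law vacation_law rate 1 z \<omega> u * (LINT x|M. of_bool (Q (present c x))
        * (weight c (n + m) x * psi_H service_law rate 1 z \<omega> u ^ present c x (n + m)))"
    unfolding add_Suc_right
  proof (rule event_step[OF Suc.prems])
    fix k k' :: "nat \<Rightarrow> nat" assume "\<And>i. i \<le> n + m \<Longrightarrow> k i = k' i"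
    then show "Q k = Q k'" by (intro Q) simp
  qed
  also have "\<dots> = psi_V service_law vacation_law rate 1 z \<omega> u
      * ((\<Prod>r = 1..m. psi_V service_law vacation_law rate r z \<omega> (psi_H service_law rate 1 z \<omega> u))
        * (LINT x|M. of_bool (Q (present c x)) * (weight c n x
          * psi_H service_law rate m z \<omega> (psi_H service_law rate 1 z \<omega> u) ^ present c x n)))"
    using Suc.IH[OF norm_psi_H_le[OF Suc.prems, of 1]] by (simp only:)
  finally show ?case
    unfolding prod_psi_V_Suc_shift psi_H_Suc_shift[of _ _ m] by (simp only: mult.assoc)
qed simp

end

section \<open>First passage and renewal\<close>

context gated_vacation_queue
begin

definition first_empty :: "nat \<Rightarrow> 'a \<Rightarrow> nat" where
  "first_empty c x = (LEAST n. 1 \<le> n \<and> present c x n = 0)"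

text \<open>The value \<open>0\<close> stands for a cycle that never ends, whereas \<open>first_empty\<close> is then an
  unspecified constant.\<close>

definition cycle_end :: "nat \<Rightarrow> 'a \<Rightarrow> nat" where
  "cycle_end c x = (if \<exists>n\<ge>1. present c x n = 0 then first_empty c x else 0)"

lemma cycle_end_eq_iff:
  assumes "1 \<le> n"
  shows "cycle_end c x = n \<longleftrightarrow> present c x n = 0 \<and> (\<forall>i. 1 \<le> i \<and> i < n \<longrightarrow> present c x i \<noteq> 0)"
proof (cases "\<exists>n\<ge>1. present c x n = 0")
  case True
  then have ex: "\<exists>n. 1 \<le> n \<and> present c x n = 0" by blast
  have eq: "cycle_end c x = (LEAST n. 1 \<le> n \<and> present c x n = 0)"
    using True by (simp add: cycle_end_def first_empty_def)
  show ?thesis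
    unfolding eq using LeastI_ex[OF ex] not_less_Least[where P="\<lambda>n. 1 \<le> n \<and> present c x n = 0"] assms
    by (auto intro!: Least_equality simp: not_less[symmetric])
next
  case False
  then show ?thesis using assms by (auto simp: cycle_end_def)
qed

lemma cycle_end_ge_1_iff: "1 \<le> cycle_end c x \<longleftrightarrow> (\<exists>n\<ge>1. present c x n = 0)"
proof (cases "\<exists>n\<ge>1. present c x n = 0")
  case True
  then have ex: "\<exists>n. 1 \<le> n \<and> present c x n = 0" by blast
  then show ?thesis using LeastI_ex[OF ex] True by (simp add: cycle_end_def first_empty_def)
qed (auto simp: cycle_end_def)

lemma first_empty_measurable [measurable]: "first_empty c \<in> measurable M (count_space UNIV)"
  unfolding first_empty_def[abs_def] by measurable

lemma cycle_end_measurable [measurable]: "cycle_end c \<in> measurable M (count_space UNIV)"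
  unfolding cycle_end_def[abs_def] by measurable

lemma cycle_end_eq_first_empty: "1 \<le> cycle_end c x \<Longrightarrow> cycle_end c x = first_empty c x"
  by (auto simp: cycle_end_def split: if_splits)

lemma busy_cycle_ends_iff:
  "busy_cycle_ends (\<lambda>t. A t x) (\<lambda>i. H i x) (\<lambda>i. V i x) \<longleftrightarrow> 1 \<le> cycle_end 1 x"
  unfolding busy_cycle_ends_def empty_at_vacation_end_iff cycle_end_ge_1_iff present_def ..

lemma cycle_vacations_eq:
  "cycle_vacations (\<lambda>t. A t x) (\<lambda>i. H i x) (\<lambda>i. V i x) = first_empty 1 x"
  unfolding cycle_vacations_def empty_at_vacation_end_iff first_empty_def present_def ..

end

section \<open>The renewal equation and its summation\<close>

context gated_vacation_transform
begin

abbreviation \<psi>H :: "nat \<Rightarrow> complex" where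
  "\<psi>H n \<equiv> psi_H service_law rate n z \<omega> 0"

abbreviation \<psi>V :: "nat \<Rightarrow> complex" where
  "\<psi>V n \<equiv> psi_V service_law vacation_law rate n z \<omega> 0"

text \<open>These are the f_n^c of the renewal equation. The conjunct \<open>1 \<le> n\<close> makes
  the term at 0 vanish, as \<open>cycle_end\<close> takes the value 0 on cycles without end.\<close>

definition passage :: "nat \<Rightarrow> nat \<Rightarrow> complex" where
  "passage c n = (LINT x|M. of_bool (1 \<le> n \<and> cycle_end c x = n) * weight c n x)"

lemma passage_0 [simp]: "passage c 0 = 0"
  by (simp add: passage_def)

text \<open>At \<open>u = 0\<close>, the factor \<open>u\<close> to the power of the queue length is the indicator of an empty
  system, as \<open>0\<^sup>0 = 1\<close>.\<close>

lemma renewal: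
  assumes "1 \<le> n"
  shows "\<psi>H n ^ c * (\<Prod>m = 1..n. \<psi>V m) = (\<Sum>k\<le>n. passage c k * (\<Prod>m = 1..n - k. \<psi>V m))"
proof -
  let ?W = "\<lambda>x. weight c n x * 0 ^ present c x n"
  have int: "integrable M ?W"
    by (rule integrable_weight) simp
  \<comment> \<open>These are \<open>n\<close> steps from epoch 0 under the sure event; there the
    weight is 1 and \<open>c\<close> customers are present.\<close>
  have "\<psi>H n ^ c * (\<Prod>m = 1..n. \<psi>V m) = (LINT x|M. ?W x)"
  proof -
    have "(LINT x|M. of_bool True * (weight c (0 + n) x * 0 ^ present c x (0 + n)))
        = (\<Prod>m = 1..n. \<psi>V m) * (LINT x|M. of_bool True * (weight c 0 x * \<psi>H n ^ present c x 0))"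
      by (rule event_steps) auto
    also have "(LINT x|M. of_bool True * (weight c 0 x * \<psi>H n ^ present c x 0)) = (LINT x|M. \<psi>H n ^ c)"
      by (intro Bochner_Integration.integral_cong refl) (simp add: weight_def)
    finally show ?thesis by (simp add: prob_space)
  qed
  also have "\<dots> = (LINT x|M. (\<Sum>k\<le>n. of_bool (1 \<le> k \<and> cycle_end c x = k) * ?W x))"
  proof (intro Bochner_Integration.integral_cong refl)
    fix x
    \<comment> \<open>If the system is empty at \<open>n\<close>, the first passage has occurred by
      then and exactly one indicator is 1; otherwise \<open>?W x\<close> is zero.\<close>
    show "?W x = (\<Sum>k\<le>n. of_bool (1 \<le> k \<and> cycle_end c x = k) * ?W x)"
    proof (cases "present c x n = 0")
      case True
      have "1 \<le> cycle_end c x"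
        using True assms cycle_end_ge_1_iff by blast
      moreover have "cycle_end c x \<le> n"
        using True assms cycle_end_eq_iff[of "cycle_end c x" c x] calculation by (meson linorder_not_less)
      ultimately have "(\<Sum>k\<le>n. of_bool (1 \<le> k \<and> cycle_end c x = k)) = (\<Sum>k\<le>n. if cycle_end c x = k then 1 else 0 :: complex)"
        by (intro sum.cong) auto
      also have "\<dots> = 1"
        using \<open>cycle_end c x \<le> n\<close> by (subst sum.delta') auto
      finally show ?thesis by (simp flip: sum_distrib_right)
    qed simp
  qed
  also have "\<dots> = (\<Sum>k\<le>n. (LINT x|M. of_bool (1 \<le> k \<and> cycle_end c x = k) * ?W x))"
    by (rule Bochner_Integration.integral_sum)
      (rule Bochner_Integration.integrable_bound[OF int], auto)
  also have "\<dots> = (\<Sum>k\<le>n. passage c k * (\<Prod>m = 1..n - k. \<psi>V m))"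
  proof (rule sum.cong)
    fix k assume k: "k \<in> {..n}"
    show "(LINT x|M. of_bool (1 \<le> k \<and> cycle_end c x = k) * ?W x) = passage c k * (\<Prod>m = 1..n - k. \<psi>V m)"
    proof (cases "1 \<le> k")
      case True
      define Q where "Q p \<longleftrightarrow> p k = 0 \<and> (\<forall>i. 1 \<le> i \<and> i < k \<longrightarrow> p i \<noteq> 0)" for p :: "nat \<Rightarrow> nat"
      have Q: "1 \<le> k \<and> cycle_end c x = k \<longleftrightarrow> Q (present c x)" for x
        using True by (simp add: Q_def cycle_end_eq_iff)
      have "(LINT x|M. of_bool (Q (present c x)) * (weight c (k + (n - k)) x * 0 ^ present c x (k + (n - k))))
        = (\<Prod>m = 1..n - k. \<psi>V m)
          * (LINT x|M. of_bool (Q (present c x)) * (weight c k x * \<psi>H (n - k) ^ present c x k))"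
      proof (rule event_steps)
        fix p p' :: "nat \<Rightarrow> nat" assume "\<And>i. i \<le> k \<Longrightarrow> p i = p' i"
        then show "Q p = Q p'" by (simp add: Q_def)
      qed simp
      \<comment> \<open>On \<open>Q\<close> nobody is present at epoch \<open>k\<close>, so the
        power of \<open>\<psi>H\<close> is 1.\<close>
      also have "(LINT x|M. of_bool (Q (present c x)) * (weight c k x * \<psi>H (n - k) ^ present c x k)) = passage c k"
        unfolding passage_def Q by (intro Bochner_Integration.integral_cong refl) (auto simp: Q_def)
      finally show ?thesis using k unfolding Q by (simp add: mult.commute)
    next
      case False
      then have "k = 0" by simp
      then show ?thesis by simp
    qed
  qed simp
  finally show ?thesis .
qed

text \<open>The weights have norm at most 1, so the probabilities of
  \<open>cycle_end c x = n\<close> dominate, whether or not the products of the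
  \<open>\<psi>V\<close> are summable.\<close>

lemma summable_norm_passage: "summable (\<lambda>n. norm (passage c n))"
proof (rule summable_comparison_test')
  show "summable (\<lambda>n. LINT x|M. of_bool (cycle_end c x = n) * (1 :: real))"
    by (rule sums_summable[OF integral_partition_sums]) simp_all
  show "norm (norm (passage c n)) \<le> (LINT x|M. of_bool (cycle_end c x = n) * (1 :: real))" if "0 \<le> n" for n
    unfolding passage_def real_norm_def abs_norm_cancel
    by (rule norm_integral_le)
      (use norm_weight_le in \<open>auto simp: norm_mult intro!: integrable_const_bound[where B=1]\<close>)
qed

lemma passage_sums: "passage c sums (LINT x|M. of_bool (1 \<le> cycle_end c x) * weight c (cycle_end c x) x)"
proof -
  have [measurable]: "(\<lambda>x. weight c (cycle_end c x) x) \<in> borel_measurable M"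
    by (rule measurable_compose_countable[where g="cycle_end c" and f="weight c"]) measurable
  have "integrable M (\<lambda>x. of_bool (1 \<le> cycle_end c x) * weight c (cycle_end c x) x)"
    using norm_weight_le by (intro integrable_const_bound[where B=1]) (auto simp: norm_mult)
  from integral_partition_sums[OF cycle_end_measurable[of c] this]
  show ?thesis
    by (rule sums_cong[THEN iffD1, rotated])
      (unfold passage_def, intro Bochner_Integration.integral_cong refl, auto)
qed

lemma cycle_weight_eq:
  "z ^ cycle_served (\<lambda>t. A t x) (\<lambda>i. H i x) (\<lambda>i. V i x)
      * exp (- \<omega> * of_real (cycle_length (\<lambda>t. A t x) (\<lambda>i. H i x) (\<lambda>i. V i x)))
    = weight 1 (first_empty 1 x) x"
  unfolding weight_def cycle_served_def cycle_length_def cycle_vacations_eq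
    served_def epoch_def vacation_end_eq_chain ..

text \<open>Where the cycle ends, \<open>first_empty\<close> and \<open>cycle_end\<close> agree; by
  assumption the other paths form a null set.\<close>

lemma passage_sums_joint_transform:
  assumes "AE x in M. busy_cycle_ends (\<lambda>t. A t x) (\<lambda>i. H i x) (\<lambda>i. V i x)"
  shows "passage 1 sums joint_transform M A H V z \<omega>"
proof -
  have eq: "weight 1 (first_empty 1 x) x = of_bool (1 \<le> cycle_end 1 x) * weight 1 (cycle_end 1 x) x"
    if "1 \<le> cycle_end 1 x" for x
    using that cycle_end_eq_first_empty[OF that] by simp
  from assms have "AE x in M. weight 1 (first_empty 1 x) x
      = of_bool (1 \<le> cycle_end 1 x) * weight 1 (cycle_end 1 x) x"
    unfolding busy_cycle_ends_iff by (rule eventually_mono) (rule eq)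
  moreover have "(\<lambda>x. of_bool (1 \<le> cycle_end 1 x) * weight 1 (cycle_end 1 x) x) \<in> borel_measurable M"
    by (rule measurable_compose_countable[where g="cycle_end 1" and f="\<lambda>n x. of_bool (1 \<le> n) * weight 1 n x"])
      measurable
  moreover have "(\<lambda>x. weight 1 (first_empty 1 x) x) \<in> borel_measurable M"
    by (rule measurable_compose_countable[where g="first_empty 1" and f="weight 1"]) measurable
  ultimately have "joint_transform M A H V z \<omega> = (LINT x|M. of_bool (1 \<le> cycle_end 1 x) * weight 1 (cycle_end 1 x) x)"
    unfolding joint_transform_def cycle_weight_eq by (intro integral_cong_AE)
  then show ?thesis using passage_sums[of 1] by simp
qed

lemma suminf_prod_psi_V_nonzero:
  assumes b: "summable (\<lambda>n. \<Prod>m = 1..n. \<psi>V m)"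
  shows "(\<Sum>n. \<Prod>m = 1..n. \<psi>V m) \<noteq> 0"
proof -
  define b where "b n = (\<Prod>m = 1..n. \<psi>V m)" for n
  define a where "a n = (\<Sum>k\<le>n. passage 0 k * b (n - k))" for n
  have "a sums (suminf (passage 0) * suminf b)"
    using summable_norm_passage b[folded b_def] by (rule renewal_sums) (simp add: a_def)
  \<comment> \<open>The renewal equation starts at \<open>n = 1\<close>; at 0 the convolution
    vanishes while the empty product is 1.\<close>
  moreover have "a n = b n - of_bool (n = 0)" for n
    using renewal[of n 0] by (cases "n = 0") (simp_all add: a_def b_def)
  moreover have "(\<lambda>n. b n - of_bool (n = 0)) sums (suminf b - 1)"
  proof (rule sums_diff)
    show "b sums suminf b"
      using b[folded b_def] by (rule summable_sums)
    show "(\<lambda>n. of_bool (n = 0)) sums (1 :: complex)"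
      using sums_single[of 0 "\<lambda>_. 1 :: complex"] by (simp add: of_bool_def eq_commute)
  qed
  ultimately have "suminf (passage 0) * suminf b = suminf b - 1"
    using sums_unique2 by (metis (no_types, lifting) sums_cong)
  then have "suminf b \<noteq> 0" by auto
  then show ?thesis unfolding b_def .
qed

lemma numerator_sums:
  assumes b: "summable (\<lambda>n. \<Prod>m = 1..n. \<psi>V m)"
  shows "(\<lambda>n. \<psi>H (Suc n) * (\<Prod>m = 1..Suc n. \<psi>V m)) sums
    (suminf (passage 1) * (\<Sum>n. \<Prod>m = 1..n. \<psi>V m))"
proof -
  define a where "a n = (\<Sum>k\<le>n. passage 1 k * (\<Prod>m = 1..n - k. \<psi>V m))" for n
  have "a sums (suminf (passage 1) * (\<Sum>n. \<Prod>m = 1..n. \<psi>V m))"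
    using summable_norm_passage b by (rule renewal_sums) (simp add: a_def)
  moreover have "a 0 = 0" by (simp add: a_def)
  moreover have "a (Suc n) = \<psi>H (Suc n) * (\<Prod>m = 1..Suc n. \<psi>V m)" for n
    using renewal[of "Suc n" 1] unfolding a_def by (simp only: power_one_right)
  ultimately show ?thesis
    using sums_Suc_iff[of a] by simp
qed

text \<open>The iteration starts at 0 and each step has the outer factor \<open>z\<close>. For
  \<open>cmod z < 1\<close> this keeps the iterates uniformly away from 1.\<close>

lemma norm_psi_H_0_le: "norm (\<psi>H n) \<le> norm z"
proof (cases n)
  case (Suc k)
  let ?s = "\<omega> + of_real rate - of_real rate * \<psi>H k"
  have "norm (\<psi>H k) \<le> 1" by (rule norm_psi_H_le) simp
  then have "norm (lst service_law ?s) \<le> 1"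
    using norm_lst_le[OF service_measurable service_nonneg, of ?s 0] Re_psi_argument
    by (simp add: service_distr)
  then show ?thesis
    using Suc by (simp add: norm_mult mult_left_le)
qed simp

lemma summable_prod_psi_V:
  assumes V: "0 < measure vacation_law {0<..}" and strict: "cmod z < 1 \<or> 0 < Re \<omega>"
  shows "summable (\<lambda>n. \<Prod>m = 1..n. \<psi>V m)"
proof -
  \<comment> \<open>A lower bound, uniform in \<open>m\<close>, for the real part of the argument of
    the vacation transform in \<open>\<psi>V m\<close>.\<close>
  define \<delta> where "\<delta> = Re \<omega> + rate * (1 - norm z)"
  have "0 \<le> rate * (1 - norm z)" "cmod z < 1 \<Longrightarrow> 0 < rate * (1 - norm z)"
    using z rate_pos by simp_all
  then have \<delta>: "0 < \<delta>"
    using strict \<omega> unfolding \<delta>_def by linarith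
  obtain q where q: "0 \<le> q" "q < 1" and lst_le: "\<And>s. \<delta> \<le> Re s \<Longrightarrow> norm (lst vacation_law s) \<le> q"
    using norm_lst_le_uniform[OF vacation_measurable vacation_nonneg, of 0 \<delta>] V \<delta>
    by (auto simp: vacation_distr)
  have psi_V_le: "norm (\<psi>V m) \<le> q" for m
  proof -
    have H: "norm (\<psi>H (m - 1)) \<le> norm z" "norm (\<psi>H (m - 1)) \<le> 1"
      using norm_psi_H_0_le[of "m - 1"] z by simp_all
    have "\<delta> \<le> Re \<omega> + rate * (1 - norm (\<psi>H (m - 1)))"
      unfolding \<delta>_def using H(1) rate_pos by (simp add: mult_left_mono)
    also have "\<dots> \<le> Re (\<omega> + of_real rate - of_real rate * \<psi>H (m - 1))"
      using H(2) by (rule Re_psi_argument)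
    finally show ?thesis
      unfolding psi_V_def by (rule lst_le)
  qed
  have "norm (\<Prod>m = 1..n. \<psi>V m) \<le> q ^ n" for n
  proof -
    have "norm (\<Prod>m = 1..n. \<psi>V m) \<le> (\<Prod>m = 1..n. q)"
      unfolding prod_norm[symmetric] by (intro prod_mono) (simp add: psi_V_le)
    then show ?thesis by simp
  qed
  then show ?thesis
    using q by (intro summable_comparison_test'[OF summable_geometric[of q], of 0]) auto
qed

end

section \<open>Almost sure termination of the busy cycle\<close>

context gated_vacation_queue
begin

lemma AE_busy_cycle_ends:
  assumes service_mean: "integrable service_law (\<lambda>x. x)"
    and load: "rate * (LINT x|service_law. x) < 1"
    and vacation_mean: "integrable vacation_law (\<lambda>x. x)"
  shows "AE x in M. busy_cycle_ends (\<lambda>t. A t x) (\<lambda>i. H i x) (\<lambda>i. V i x)"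
proof -
  \<comment> \<open>All weights are 1 here, so the sum of \<open>passage 1\<close> is the
    probability that the cycle ends.\<close>
  interpret gated_vacation_transform M rate A service_law vacation_law H V 1 0
    by unfold_locales auto
  have H_int: "integrable M (H 0)" and EH: "(LINT x|service_law. x) = expectation (H 0)"
    using service_mean unfolding service_distr[of 0, symmetric]
    by (simp_all add: integrable_distr_eq integral_distr)
  have V_int: "integrable M (V 0)"
    using vacation_mean unfolding vacation_distr[of 0, symmetric] by (simp add: integrable_distr_eq)
  define \<rho> where "\<rho> = rate * expectation (H 0)"
  have \<rho>: "0 \<le> \<rho>" "\<rho> < 1"
    using load rate_pos service_nonneg by (auto simp: \<rho>_def EH intro!: mult_nonneg_nonneg integral_nonneg)
  \<comment> \<open>Arguments that are real and nonnegative give access to the positivity of the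
    transforms, so that no \<open>\<psi>V (Suc n)\<close> vanishes.\<close>
  have real: "\<exists>r. \<psi>H n = of_real r \<and> 0 \<le> r \<and> r \<le> 1" for n
  proof (induction n)
    case 0
    then show ?case by (intro exI[of _ 0]) simp
  next
    case (Suc n)
    then obtain r where r: "\<psi>H n = of_real r" "0 \<le> r" "r \<le> 1" by auto
    define e where "e = expectation (\<lambda>x. exp (- (rate - rate * r) * H 0 x))"
    have s: "0 \<le> rate - rate * r"
      using r rate_pos by (simp add: mult_left_le)
    have e: "\<psi>H (Suc n) = of_real e" "0 < e"
      using lst_of_real[OF service_measurable service_nonneg s, of 0] r(1)
      by (simp_all add: service_distr e_def)
    moreover have "norm (\<psi>H (Suc n)) \<le> 1"
      by (rule norm_psi_H_le) simp
    ultimately show ?case by (intro exI[of _ e]) simp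
  qed
  \<comment> \<open>Each step contracts the distance to 1 by \<open>\<rho>\<close>: the transform is
    taken at \<open>rate * (1 - \<psi>H n)\<close>, and the mean service time is the Lipschitz
    constant.\<close>
  have psi_H_dist: "norm (\<psi>H n - 1) \<le> \<rho> ^ n" for n
  proof (induction n)
    case (Suc n)
    let ?s = "0 + of_real rate - of_real rate * \<psi>H n"
    have "norm (\<psi>H n) \<le> 1" by (rule norm_psi_H_le) simp
    then have "norm (\<psi>H (Suc n) - 1) \<le> norm ?s * expectation (H 0)"
      using norm_lst_minus_one_le[OF service_measurable service_nonneg Re_psi_argument(2) H_int, of "\<psi>H n"]
      by (simp add: service_distr)
    also have "norm ?s = rate * norm (\<psi>H n - 1)"
    proof -
      have "?s = of_real rate * (1 - \<psi>H n)" by (simp add: algebra_simps)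
      then show ?thesis using rate_pos by (simp only: norm_mult) (simp add: norm_minus_commute)
    qed
    also have "rate * norm (\<psi>H n - 1) * expectation (H 0) = \<rho> * norm (\<psi>H n - 1)"
      by (simp add: \<rho>_def)
    also have "\<dots> \<le> \<rho> * \<rho> ^ n"
      using Suc \<rho> by (intro mult_left_mono)
    finally show ?case by simp
  qed simp
  have psi_H_lim: "\<psi>H \<longlonglongrightarrow> 1"
  proof -
    have "(\<lambda>n. \<psi>H n - 1) \<longlonglongrightarrow> 0"
      by (rule Lim_null_comparison[of _ "\<lambda>n. \<rho> ^ n"]) (use psi_H_dist \<rho> in \<open>auto intro!: LIMSEQ_power_zero always_eventually\<close>)
    then show ?thesis by (simp add: LIM_zero_iff)
  qed
  have psi_V_dist: "norm (\<psi>V (Suc n) - 1) \<le> rate * expectation (V 0) * \<rho> ^ n" for n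
  proof -
    let ?s = "0 + of_real rate - of_real rate * \<psi>H n"
    have "norm (\<psi>H n) \<le> 1" by (rule norm_psi_H_le) simp
    then have "norm (\<psi>V (Suc n) - 1) \<le> norm ?s * expectation (V 0)"
      using norm_lst_minus_one_le[OF vacation_measurable vacation_nonneg Re_psi_argument(2) V_int, of "\<psi>H n"]
      by (simp add: vacation_distr psi_V_def)
    also have "norm ?s = rate * norm (\<psi>H n - 1)"
    proof -
      have "?s = of_real rate * (1 - \<psi>H n)" by (simp add: algebra_simps)
      then show ?thesis using rate_pos by (simp only: norm_mult) (simp add: norm_minus_commute)
    qed
    also have "rate * norm (\<psi>H n - 1) * expectation (V 0) \<le> rate * \<rho> ^ n * expectation (V 0)"
      using psi_H_dist[of n] rate_pos vacation_nonneg
      by (intro mult_right_mono mult_left_mono integral_nonneg) auto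
    finally show ?thesis by (simp add: mult_ac)
  qed
  have psi_V_nonzero: "\<psi>V (Suc n) \<noteq> 0" for n
  proof -
    obtain r where r: "\<psi>H n = of_real r" "0 \<le> r" "r \<le> 1" using real by blast
    have s: "0 \<le> rate - rate * r"
      using r rate_pos by (simp add: mult_left_le)
    show ?thesis
      using lst_of_real[OF vacation_measurable vacation_nonneg s, of 0] r(1)
      by (simp add: vacation_distr psi_V_def)
  qed
  \<comment> \<open>This makes the infinite product converge absolutely; as its factors are nonzero,
    so is its limit \<open>L\<close>, which can be cancelled at the end.\<close>
  have "summable (\<lambda>n. norm (\<psi>V (Suc n) - 1))"
  proof (rule summable_comparison_test')
    show "summable (\<lambda>n. rate * expectation (V 0) * \<rho> ^ n)"
      using \<rho> by (intro summable_mult summable_geometric) simp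
    show "norm (norm (\<psi>V (Suc n) - 1)) \<le> rate * expectation (V 0) * \<rho> ^ n" if "0 \<le> n" for n
      using psi_V_dist by simp
  qed
  then have "convergent_prod (\<lambda>n. \<psi>V (Suc n))"
    by (intro abs_convergent_prod_imp_convergent_prod summable_imp_abs_convergent_prod)
  then obtain L where "(\<lambda>n. \<Prod>i\<le>n. \<psi>V (Suc i)) \<longlonglongrightarrow> L" "L \<noteq> 0"
    using convergent_prod_iff_nz_lim[of "\<lambda>n. \<psi>V (Suc n)"] psi_V_nonzero by auto
  moreover have "(\<Prod>i\<le>n. \<psi>V (Suc i)) = (\<Prod>m = 1..Suc n. \<psi>V m)" for n
    by (induction n) simp_all
  ultimately have b: "(\<lambda>n. \<Prod>m = 1..n. \<psi>V m) \<longlonglongrightarrow> L" "L \<noteq> 0"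
    by (simp_all only: LIMSEQ_imp_Suc not_False_eq_True)
  have "(\<lambda>n. \<Sum>k\<le>n. passage 1 k * (\<Prod>m = 1..n - k. \<psi>V m)) \<longlonglongrightarrow> suminf (passage 1) * L"
    using summable_norm_passage b(1) by (rule convolution_tendsto)
  \<comment> \<open>By the renewal equation the same convolutions are \<open>\<psi>H n\<close> times
    the partial products.\<close>
  moreover have "(\<lambda>n. \<Sum>k\<le>n. passage 1 k * (\<Prod>m = 1..n - k. \<psi>V m)) \<longlonglongrightarrow> 1 * L"
  proof (rule Lim_transform_eventually)
    show "(\<lambda>n. \<psi>H n * (\<Prod>m = 1..n. \<psi>V m)) \<longlonglongrightarrow> 1 * L"
      using psi_H_lim b(1) by (rule tendsto_mult)
    show "\<forall>\<^sub>F n in sequentially. \<psi>H n * (\<Prod>m = 1..n. \<psi>V m) = (\<Sum>k\<le>n. passage 1 k * (\<Prod>m = 1..n - k. \<psi>V m))"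
      using eventually_ge_at_top[of 1]
    proof eventually_elim
      case (elim n)
      then show ?case using renewal[of n 1] by (simp only: power_one_right)
    qed
  qed
  ultimately have "suminf (passage 1) * L = 1 * L"
    by (rule LIMSEQ_unique)
  then have "suminf (passage 1) = 1"
    using b(2) by simp
  then have "(1 :: complex) = (LINT x|M. of_bool (1 \<le> cycle_end 1 x))"
    using sums_unique[OF passage_sums[of 1]] by (simp add: weight_def)
  also have "(LINT x|M. of_bool (1 \<le> cycle_end 1 x)) = complex_of_real (prob {x \<in> space M. 1 \<le> cycle_end 1 x})"
  proof -
    have "(LINT x|M. of_bool (1 \<le> cycle_end 1 x)) = (LINT x|M. complex_of_real (indicator {x \<in> space M. 1 \<le> cycle_end 1 x} x))"
      by (intro Bochner_Integration.integral_cong refl) (simp add: indicator_def)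
    then show ?thesis by (simp add: integral_complex_of_real)
  qed
  finally have "prob {x \<in> space M. 1 \<le> cycle_end 1 x} = 1"
    by (rule of_real_eq_1_iff[THEN iffD1, OF sym])
  then have "AE x in M. 1 \<le> cycle_end 1 x"
    by (subst (asm) prob_Collect_eq_1) auto
  then show ?thesis
    unfolding busy_cycle_ends_iff .
qed

end

text \<open>The first clause makes the cycle length and the number served meaningful. The series can
  diverge on the boundary: at \<open>z = 1\<close>, \<open>\<omega> = 0\<close> its terms have a
  nonzero limit. Hence the formula is stated under convergence alone, for which the second clause
  gives a sufficient condition.\<close>

theorem corollary10:
  fixes M :: "'a measure" and rate :: real
    and A :: "real \<Rightarrow> 'a \<Rightarrow> nat" and H V :: "nat \<Rightarrow> 'a \<Rightarrow> real"
    and service_law vacation_law :: "real measure"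
    and z \<omega> :: complex
  defines "\<psi>H \<equiv> \<lambda>n. psi_H service_law rate n z \<omega> 0"
    and "\<psi>V \<equiv> \<lambda>n. psi_V service_law vacation_law rate n z \<omega> 0"
  assumes queue: "gated_vacation_queue M rate A service_law vacation_law H V"
    and service_mean: "integrable service_law (\<lambda>x. x)"
    and load: "rate * (LINT x|service_law. x) < 1"
    and vacation_mean: "integrable vacation_law (\<lambda>x. x)"
    and z: "cmod z \<le> 1" and \<omega>: "0 \<le> Re \<omega>"
  shows "(AE x in M. busy_cycle_ends (\<lambda>t. A t x) (\<lambda>i. H i x) (\<lambda>i. V i x)) \<and>
    (0 < measure vacation_law {0<..} \<and> (cmod z < 1 \<or> 0 < Re \<omega>) \<longrightarrow>
       summable (\<lambda>n. \<Prod>m = 1..Suc n. \<psi>V m)) \<and>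
    (summable (\<lambda>n. \<Prod>m = 1..Suc n. \<psi>V m) \<longrightarrow>
       summable (\<lambda>n. \<psi>H (Suc n) * (\<Prod>m = 1..Suc n. \<psi>V m)) \<and>
       1 + (\<Sum>n. \<Prod>m = 1..Suc n. \<psi>V m) \<noteq> 0 \<and>
       joint_transform M A H V z \<omega> =
         (\<Sum>n. \<psi>H (Suc n) * (\<Prod>m = 1..Suc n. \<psi>V m)) /
         (1 + (\<Sum>n. \<Prod>m = 1..Suc n. \<psi>V m)))"
proof -
  interpret gated_vacation_transform M rate A service_law vacation_law H V z \<omega>
    using queue z \<omega> by (intro gated_vacation_transform.intro gated_vacation_transform_axioms.intro)
  have ends: "AE x in M. busy_cycle_ends (\<lambda>t. A t x) (\<lambda>i. H i x) (\<lambda>i. V i x)"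
    using service_mean load vacation_mean by (rule AE_busy_cycle_ends)
  let ?b = "\<lambda>n. \<Prod>m = 1..n. \<psi>V m"
  have shift: "summable (\<lambda>n. ?b (Suc n)) \<longleftrightarrow> summable ?b"
    by (rule summable_Suc_iff)
  have "summable (\<lambda>n. \<psi>H (Suc n) * ?b (Suc n)) \<and> 1 + (\<Sum>n. ?b (Suc n)) \<noteq> 0 \<and>
      joint_transform M A H V z \<omega> = (\<Sum>n. \<psi>H (Suc n) * ?b (Suc n)) / (1 + (\<Sum>n. ?b (Suc n)))"
    if "summable ?b"
  proof -
    \<comment> \<open>The 1 in the denominator is the empty product, the term of index 0.\<close>
    have "1 + (\<Sum>n. ?b (Suc n)) = suminf ?b"
      using suminf_split_head[OF that] by simp
    moreover have "suminf ?b \<noteq> 0"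
      using suminf_prod_psi_V_nonzero that unfolding \<psi>V_def by blast
    moreover have "(\<lambda>n. \<psi>H (Suc n) * ?b (Suc n)) sums (joint_transform M A H V z \<omega> * suminf ?b)"
      using numerator_sums that sums_unique[OF passage_sums_joint_transform[OF ends]]
      unfolding \<psi>V_def \<psi>H_def by simp
    ultimately show ?thesis
      by (simp add: sums_iff)
  qed
  then show ?thesis
    using ends summable_prod_psi_V shift unfolding \<psi>V_def \<psi>H_def by blast
qed

end
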